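(* Let $(T,f)$ and $(G,g)$ be merge trees with associated metric merge trees $\mathbf{T}$ and $\mathbf{G}$, let $\varepsilon\ge0$, and let $\alpha:\mathbf{T}\to\mathbf{G}$ and $\beta:\mathbf{G}\to\mathbf{T}$ be $\varepsilon$-good maps. Then there is a coupling $C\in\mathcal{C}(T,G)$ such that $\|C\|_\infty\le\varepsilon$.
   Context: **Merge trees.** A merge tree $(T,f)$ is a finite rooted tree with vertex set $V_T$ and root $r_T$, the root having order (number of incident edges) $>1$, together with an injective function $f:V_T\to\mathbb{R}$ which is strictly increasing for the partial order on $V_T$ generated by child $<$ father (so $r_T$ is the maximum). $\mathrm{LCA}$ denotes the least common ancestor (least upper bound) of a set of vertices. The metric merge tree $\mathbf{T}$ is obtained by gluing, along common vertices, an interval $[f(x),f(x')]$ for each edge from a child $x$ to its father $x'$, and a half-line $[f(r_T),+\infty)$ at the root. It carries the shortest path metric, contains $V_T$, and $f$ and the partial order extend to it (for each $x$ the set $\{x'\ge x\}$ is a chain mapped by $f$ bijectively onto $[f(x),+\infty)$). For $k\ge 0$, $s_T^k(x)$ is the unique $x'\ge x$ with $f(x')=f(x)+k$. **$\varepsilon$-good maps.** A continuous map $\alpha:\mathbf{T}\to\mathbf{G}$ is $\varepsilon$-good if: (P1) $g(\alpha(x))=f(x)+\varepsilon$ for all $x\in\mathbf{T}$; (P2) if $\alpha(x)<\alpha(x')$ then $s_T^{2\varepsilon}(x)<s_T^{2\varepsilon}(x')$; (P3) if $y\in\mathbf{G}-\alpha(\mathbf{T})$ and $w=\min\{y'>y\mid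 y'\in\alpha(\mathbf{T})\}$, then $g(w)-g(y)\le 2\varepsilon$. The definition for $\beta:\mathbf{G}\to\mathbf{T}$ is the same with the roles exchanged. **Couplings.** For $C\subset V_T\times V_G$ with projections $\pi_T,\pi_G$, let $\Lambda_C^T(v)$ be the set of maximal elements of $\{v'\in\pi_T(C)\mid v'<v\}$ (possibly empty); similarly $\Lambda_C^G$. Order $C$ by $(a,b)<(c,d)$ iff $a<c$ and $b<d$. $C$ is a coupling, $C\in\mathcal{C}(T,G)$, if: (C1) $\#\max C=1$ (equivalently $\#\max\pi_T(C)=\#\max\pi_G(C)=1$); (C2) $\pi_T$ and $\pi_G$ are injective on $C$; (C3) for $(a,b),(c,d)\in C$, $a<c$ iff $b<d$; (C4) $a\in\pi_T(C)$ implies $\#\Lambda_C^T(a)\ne 1$, and the same for $G$. The unused vertices are $U_C^T=\{v\in V_T\mid \#\Lambda_C^T(v)=1\}$, the deleted ones are $D_C^T=\{v\in V_T\mid v\notin\pi_T(C),\ \#\Lambda_C^T(v)\neq 1\}$; $V_T$ is the disjoint union of $\pi_T(C),U_C^T,D_C^T$. Same for $G$. **The vertex maps.** For $x\in V_T$ let: $\varphi(x)=\min\{v\in V_T\mid v>x,\ \exists v'\le v \text{ with } v'\in\pi_T(C)\}$; $\eta(x)\in V_G$ the vertex $w$ minimizing $g(w)$ among all $(v,w)\in C$ with $v\le\varphi(x)$; $\chi(x)=\mathrm{LCA}\{w\mid (v,w)\in C,\ v\in\Lambda_C^T(x)\}\in V_G$. Define $\alpha_C:V_T-U_C^T\to\mathbf{G}$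 by: $\alpha_C(x)=y$ if $(x,y)\in C$; if $x\in D_C^T$ and $\#\Lambda_C^T(x)=0$, $\alpha_C(x)$ is the point of $\mathbf{G}$ above $\eta(x)$ at height $\max\{g(\eta(x)),\tfrac12(f(x)+f(\varphi(x)))\}$; if $x\in D_C^T$ and $\#\Lambda_C^T(x)>1$, $\alpha_C(x)=\chi(x)$. The map $\beta_C:V_G-U_C^G\to\mathbf{T}$ is defined in the same way exchanging the roles of $(T,f)$ and $(G,g)$. **Cost.** $\|C\|_\infty=\max\{\max_{x\in V_T-U_C^T}|g(\alpha_C(x))-f(x)|,\ \max_{y\in V_G-U_C^G}|f(\beta_C(y))-g(y)|\}$. *)

theory Defs
  imports "HOL-Analysis.Analysis"
begin

section \<open>Merge trees\<close>

text \<open>An element \<open>(x, x')\<close> of \<open>edges\<close> is the edge from the child \<open>x\<close> to its father \<open>x'\<close>.\<close>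

record 'v mtree =
  verts :: "'v set"
  edges :: "('v \<times> 'v) set"
  root :: "'v"
  height :: "'v \<Rightarrow> real"

definition vle :: "'v mtree \<Rightarrow> 'v \<Rightarrow> 'v \<Rightarrow> bool" where
  "vle T x y \<longleftrightarrow> (x, y) \<in> (edges T)\<^sup>*"

definition vless :: "'v mtree \<Rightarrow> 'v \<Rightarrow> 'v \<Rightarrow> bool" where
  "vless T x y \<longleftrightarrow> vle T x y \<and> x \<noteq> y"

locale merge_tree =
  fixes T :: "'v mtree"
  assumes finite_verts: "finite (verts T)"
    and root_in: "root T \<in> verts T"
    and edges_in: "edges T \<subseteq> verts T \<times> verts T"
    and root_no_father: "(root T, y) \<notin> edges T"
    and unique_father: "x \<in> verts T \<Longrightarrow> x \<noteq> root T \<Longrightarrow> \<exists>!y. (x, y) \<in> edges T"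
    and below_root: "x \<in> verts T \<Longrightarrow> vle T x (root T)"
    and root_order: "card {e \<in> edges T. fst e = root T \<or> snd e = root T} > 1"
    and height_inj: "inj_on (height T) (verts T)"
    and height_mono: "x \<in> verts T \<Longrightarrow> y \<in> verts T \<Longrightarrow> vless T x y \<Longrightarrow> height T x < height T y"

definition least_in :: "('p \<Rightarrow> 'p \<Rightarrow> bool) \<Rightarrow> 'p set \<Rightarrow> 'p" where
  "least_in le A = (THE m. m \<in> A \<and> (\<forall>a\<in>A. le m a))"

definition LCA :: "'v mtree \<Rightarrow> 'v set \<Rightarrow> 'v" where
  "LCA T S = least_in (vle T) {u \<in> verts T. \<forall>s\<in>S. vle T s u}"


section \<open>Metric merge trees\<close>

text \<open>
  A point is a pair \<open>(x, t)\<close>: the point at height \<open>t\<close> of the interval \<open>[f(x), f(x')]\<close> belonging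
  to the edge from \<open>x\<close> to its father \<open>x'\<close>, or of the half-line \<open>[f(x), \<infinity>)\<close> if \<open>x\<close> is the root.
  The gluing identifies the upper end point of that interval with the vertex \<open>x'\<close>; it is
  represented by \<open>(x', f(x'))\<close> only, whence the strict inequality \<open>t < f(x')\<close>.
\<close>

definition points :: "'v mtree \<Rightarrow> ('v \<times> real) set" where
  "points T = {(x, t). x \<in> verts T \<and> height T x \<le> t \<and> (\<forall>x'. (x, x') \<in> edges T \<longrightarrow> t < height T x')}"

definition pt :: "'v mtree \<Rightarrow> 'v \<Rightarrow> 'v \<times> real" where
  "pt T x = (x, height T x)"

definition pheight :: "'v \<times> real \<Rightarrow> real" where
  "pheight p = snd p"

definition ple :: "'v mtree \<Rightarrow> 'v \<times> real \<Rightarrow> 'v \<times> real \<Rightarrow> bool" where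
  "ple T p q \<longleftrightarrow> vle T (fst p) (fst q) \<and> pheight p \<le> pheight q"

definition pless :: "'v mtree \<Rightarrow> 'v \<times> real \<Rightarrow> 'v \<times> real \<Rightarrow> bool" where
  "pless T p q \<longleftrightarrow> ple T p q \<and> p \<noteq> q"

text \<open>
  \<open>segment T x\<close> is the closed interval (half-line for the root) attached at \<open>x\<close>, including its
  glued upper end point. A path is given by finitely many points, consecutive ones
  lying on a common segment; on a segment the distance is the difference of the heights.
\<close>

definition segment :: "'v mtree \<Rightarrow> 'v \<Rightarrow> ('v \<times> real) set" where
  "segment T x = {p \<in> points T. fst p = x} \<union> {pt T x' | x'. (x, x') \<in> edges T}"

definition is_path :: "'v mtree \<Rightarrow> 'v \<times> real \<Rightarrow> ('v \<times> real) list \<Rightarrow> 'v \<times> real \<Rightarrow> bool" where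
  "is_path T p ps q \<longleftrightarrow> ps \<noteq> [] \<and> hd ps = p \<and> last ps = q \<and>
     successively (\<lambda>a b. \<exists>x\<in>verts T. a \<in> segment T x \<and> b \<in> segment T x) ps"

fun path_len :: "('v \<times> real) list \<Rightarrow> real" where
  "path_len (a # b # ps) = \<bar>pheight a - pheight b\<bar> + path_len (b # ps)"
| "path_len _ = 0"

definition tree_dist :: "'v mtree \<Rightarrow> 'v \<times> real \<Rightarrow> 'v \<times> real \<Rightarrow> real" where
  "tree_dist T p q =
     (if p \<in> points T \<and> q \<in> points T then Inf {path_len ps | ps. is_path T p ps q} else 0)"

definition tree_topology :: "'v mtree \<Rightarrow> ('v \<times> real) topology" where
  "tree_topology T = Metric_space.mtopology (points T) (tree_dist T)"

definition point_above :: "'v mtree \<Rightarrow> 'v \<times> real \<Rightarrow> real \<Rightarrow> 'v \<times> real" where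
  "point_above T p h = (THE q. q \<in> points T \<and> ple T p q \<and> pheight q = h)"

definition shift :: "'v mtree \<Rightarrow> real \<Rightarrow> 'v \<times> real \<Rightarrow> 'v \<times> real" where
  "shift T k p = point_above T p (pheight p + k)"


context merge_tree
begin

lemma vle_refl: "vle T x x" by (simp add: vle_def)

lemma vle_trans: "vle T x y \<Longrightarrow> vle T y z \<Longrightarrow> vle T x z"
  unfolding vle_def by (rule rtrancl_trans)

lemma vle_in: "vle T x y \<Longrightarrow> x \<in> verts T \<Longrightarrow> y \<in> verts T"
  unfolding vle_def by (induction rule: rtrancl_induct) (use edges_in in auto)

lemma vle_height: "vle T x y \<Longrightarrow> x \<in> verts T \<Longrightarrow> height T x \<le> height T y"
  using height_mono[of x y] vle_in[of x y] by (cases "x = y") (auto simp: vless_def)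

lemma father_eq: "(x, y) \<in> edges T \<Longrightarrow> (x, z) \<in> edges T \<Longrightarrow> y = z"
  using unique_father[of x] root_no_father edges_in by blast

lemma edge_height: assumes "(x, y) \<in> edges T" shows "height T x < height T y"
proof -
  have v: "x \<in> verts T" "y \<in> verts T" "vle T x y" using assms edges_in by (auto simp: vle_def)
  have "x \<noteq> y"
  proof
    assume "x = y"
    have "z = x" if "vle T x z" for z
      using that unfolding vle_def
    proof (induction rule: rtrancl_induct)
      case (step u z)
      then show ?case using assms father_eq \<open>x = y\<close> by blast
    qed simp
    then show False using \<open>x = y\<close> below_root[OF v(1)] assms root_no_father by auto
  qed
  then show ?thesis using v height_mono by (simp add: vless_def)
qed

lemma vle_cases: "vle T x y \<Longrightarrow> x = y \<or> (\<exists>z. (x, z) \<in> edges T \<and> vle T z y)"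
  unfolding vle_def by (meson converse_rtranclE)

lemma vle_chain: "vle T x y \<Longrightarrow> vle T x z \<Longrightarrow> vle T y z \<or> vle T z y"
  unfolding vle_def
proof (induction rule: rtrancl_induct)
  case base then show ?case by blast
next
  case (step y y')
  then consider "(y, z) \<in> (edges T)\<^sup>*" | "(z, y) \<in> (edges T)\<^sup>*" by blast
  then show ?case
  proof cases
    case 1
    then show ?thesis by (metis converse_rtranclE father_eq r_into_rtrancl step.hyps(2))
  next
    case 2
    then show ?thesis using step.hyps(2) by (meson rtrancl.rtrancl_into_rtrancl)
  qed
qed

lemma pt_in: "x \<in> verts T \<Longrightarrow> pt T x \<in> points T"
  using edge_height by (auto simp: pt_def points_def)

lemma up_unique:
  assumes q: "q \<in> points T" "q' \<in> points T" "ple T p q" "ple T p q'" "pheight q = pheight q'"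
  shows "q = q'"
proof -
  have *: "fst a = fst b"
    if a: "a \<in> points T" "b \<in> points T" "vle T (fst a) (fst b)" "snd a = snd b" for a b
  proof (rule ccontr)
    assume "fst a \<noteq> fst b"
    then obtain z where z: "(fst a, z) \<in> edges T" "vle T z (fst b)" using vle_cases a(3) by blast
    have "snd a < height T z" using a(1) z(1) by (auto simp: points_def)
    also have "\<dots> \<le> height T (fst b)" using vle_height z edges_in by blast
    also have "\<dots> \<le> snd b" using a(2) by (auto simp: points_def)
    finally show False using a(4) by simp
  qed
  have "vle T (fst q) (fst q') \<or> vle T (fst q') (fst q)"
    using q vle_chain by (auto simp: ple_def)
  then show ?thesis using q * [of q q'] * [of q' q] by (auto simp: pheight_def prod_eq_iff)
qed

text \<open>The points above \<open>p\<close> are mapped by the height bijectively onto \<open>[pheight p, \<infinity>)\<close>.\<close>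

lemma point_above_ex1:
  assumes p: "p \<in> points T" and h: "pheight p \<le> h"
  shows "\<exists>!q. q \<in> points T \<and> ple T p q \<and> pheight q = h"
proof -
  have x: "fst p \<in> verts T" "height T (fst p) \<le> snd p" using p by (auto simp: points_def)
  define S where "S = {w \<in> verts T. vle T (fst p) w \<and> height T w \<le> h}"
  have "finite S" "fst p \<in> S"
    using finite_verts x h by (auto simp: S_def vle_refl pheight_def)
  then obtain w where w: "w \<in> S" "\<And>w'. w' \<in> S \<Longrightarrow> height T w' \<le> height T w"
    using Max_in[of "height T ` S"] Max_ge[of "height T ` S"] by (metis (no_types, lifting) empty_iff finite_imageI image_iff)
  have "h < height T z" if z: "(w, z) \<in> edges T" for z
  proof (rule ccontr)
    assume "\<not> h < height T z"
    moreover have "vle T (fst p) z" using w(1) z by (auto simp: S_def vle_def)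
    ultimately have "z \<in> S" using z edges_in by (auto simp: S_def)
    then show False using w(2) edge_height[OF z] by force
  qed
  then have "(w, h) \<in> points T" "ple T p (w, h)" "pheight (w, h) = h"
    using w(1) h by (auto simp: points_def ple_def pheight_def S_def)
  then show ?thesis using up_unique by blast
qed

lemma path_len_nonneg: "0 \<le> path_len ps"
  by (induction ps rule: path_len.induct) auto

lemma is_path_Cons2:
  "is_path T p (a # b # ps) q \<longleftrightarrow>
     p = a \<and> (\<exists>x\<in>verts T. a \<in> segment T x \<and> b \<in> segment T x) \<and> is_path T b (b # ps) q"
  by (auto simp: is_path_def)

lemma path_rev: "is_path T p ps q \<Longrightarrow> is_path T q (rev ps) p"
  by (auto simp: is_path_def hd_rev last_rev conj_commute)

lemma path_len_snoc: "ps \<noteq> [] \<Longrightarrow> path_len (ps @ [a]) = path_len ps + \<bar>pheight (last ps) - pheight a\<bar>"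
  by (induction ps rule: path_len.induct) auto

lemma path_len_rev: "path_len (rev ps) = path_len ps"
proof (induction ps rule: path_len.induct)
  case (1 a b ps)
  have "path_len (rev (a # b # ps)) = path_len (rev (b # ps)) + \<bar>pheight b - pheight a\<bar>"
    using path_len_snoc[of "rev (b # ps)" a] by (simp add: last_rev)
  then show ?case using 1 by simp
qed simp_all

lemma path_append:
  "is_path T p ps q \<Longrightarrow> is_path T q qs r \<Longrightarrow>
     is_path T p (ps @ tl qs) r \<and> path_len (ps @ tl qs) = path_len ps + path_len qs"
proof (induction ps arbitrary: p rule: path_len.induct)
  case (1 a b ps)
  then have "is_path T b (b # ps) q" "p = a" by (simp_all add: is_path_Cons2)
  then show ?case using 1 by (simp add: is_path_Cons2)
next
  case "2_1"
  then show ?case by (simp add: is_path_def)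
next
  case ("2_2" a)
  then show ?case by (cases qs) (auto simp: is_path_def)
qed

lemma path_to_root:
  assumes p: "p \<in> points T"
  shows "\<exists>ps. is_path T p ps (pt T (root T))"
proof -
  have *: "\<exists>ps. is_path T (pt T x) ps (pt T (root T))" if "vle T x (root T)" for x
    using that unfolding vle_def
  proof (induction rule: converse_rtrancl_induct)
    case base
    show ?case by (rule exI[of _ "[pt T (root T)]"]) (simp add: is_path_def)
  next
    case (step x y)
    then obtain ps where ps: "is_path T (pt T y) ps (pt T (root T))" by blast
    then obtain qs where "ps = pt T y # qs" by (cases ps) (auto simp: is_path_def)
    moreover have "x \<in> verts T" "pt T x \<in> segment T x" "pt T y \<in> segment T x"
      using step edges_in pt_in[of x] by (auto simp: segment_def pt_def)
    ultimately have "is_path T (pt T x) (pt T x # ps) (pt T (root T))"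
      using ps by (auto simp: is_path_Cons2)
    then show ?case by blast
  qed
  have x: "fst p \<in> verts T" using p by (auto simp: points_def)
  from * [OF below_root[OF x]] obtain ps where ps: "is_path T (pt T (fst p)) ps (pt T (root T))"
    by blast
  then obtain qs where "ps = pt T (fst p) # qs" by (cases ps) (auto simp: is_path_def)
  moreover have "pt T (fst p) \<in> segment T (fst p)" "p \<in> segment T (fst p)"
    using p pt_in[OF x] by (auto simp: segment_def pt_def)
  ultimately have "is_path T p (p # ps) (pt T (root T))"
    using ps x by (auto simp: is_path_Cons2)
  then show ?thesis by blast
qed

lemma path_exists: "p \<in> points T \<Longrightarrow> q \<in> points T \<Longrightarrow> \<exists>ps. is_path T p ps q"
  using path_to_root path_rev path_append by meson

lemma path_len_Lipschitz:
  assumes F: "\<And>x a b. x \<in> verts T \<Longrightarrow> a \<in> segment T x \<Longrightarrow> b \<in> segment T x \<Longrightarrow>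
                 \<bar>F a - F b\<bar> \<le> \<bar>pheight a - pheight b\<bar>"
    and "is_path T p ps q"
  shows "\<bar>F p - F q\<bar> \<le> path_len ps"
  using assms(2)
proof (induction ps arbitrary: p rule: path_len.induct)
  case (1 a b ps)
  then have "p = a" "\<bar>F b - F q\<bar> \<le> path_len (b # ps)" "\<bar>F a - F b\<bar> \<le> \<bar>pheight a - pheight b\<bar>"
    using F unfolding is_path_Cons2 by metis+
  then show ?case by simp
qed (auto simp: is_path_def)

lemma separated:
  assumes p: "p \<in> points T" and q: "q \<in> points T" and "p \<noteq> q"
  shows "\<exists>e>0. \<forall>ps. is_path T p ps q \<longrightarrow> e \<le> path_len ps"
proof (cases "pheight p = pheight q")
  case False
  then show ?thesis
    by (intro exI[of _ "\<bar>pheight p - pheight q\<bar>"]) (use path_len_Lipschitz[of pheight] in auto)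
next
  case True
  have nle: "\<not> vle T (fst p) (fst q)" "\<not> vle T (fst q) (fst p)"
    using up_unique[OF p q, of p] up_unique[OF p q, of q] \<open>p \<noteq> q\<close> True
    by (auto simp: ple_def vle_refl)
  have x: "fst p \<in> verts T" "fst q \<in> verts T" using p q by (auto simp: points_def)
  obtain z where z: "(fst p, z) \<in> edges T"
    using nle(2) below_root[OF x(2)] unique_father[OF x(1)] by metis
  define F where "F a = (if vle T (fst a) (fst p) then height T z - pheight a else 0)" for a
  have lip: "\<bar>F a - F b\<bar> \<le> \<bar>pheight a - pheight b\<bar>"
    if ab: "x \<in> verts T" "a \<in> segment T x" "b \<in> segment T x" for x a b
  proof -
    have *: "F c = (if vle T x (fst p) then height T z - pheight c else 0)"
      if c: "c \<in> segment T x" for c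
    proof (cases "fst c = x")
      case True then show ?thesis by (simp add: F_def)
    next
      case False
      then obtain y where y: "c = pt T y" "(x, y) \<in> edges T" using c by (auto simp: segment_def)
      show ?thesis
      proof (cases "x = fst p")
        case True
        then have "y = z" using y z father_eq by blast
        then have "\<not> vle T y (fst p)"
          using vle_height[of z "fst p"] edge_height[OF z] z edges_in by force
        then show ?thesis using True y \<open>y = z\<close> by (simp add: F_def pt_def pheight_def vle_refl)
      next
        case False
        then have "vle T y (fst p) \<longleftrightarrow> vle T x (fst p)"
          using y(2) vle_cases father_eq by (metis vle_def converse_rtrancl_into_rtrancl)
        then show ?thesis using y by (simp add: F_def pt_def)
      qed
    qed
    show ?thesis using * [OF ab(2)] * [OF ab(3)] by auto
  qed
  have "F p = height T z - pheight p" "F q = 0" "pheight p < height T z"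
    using nle p z by (auto simp: F_def vle_refl points_def pheight_def)
  then show ?thesis
    by (intro exI[of _ "F p"]) (use path_len_Lipschitz[of F, OF lip] in fastforce)
qed

lemma Metric_space_tree_dist: "Metric_space (points T) (tree_dist T)"
proof
  define L where "L p q = {path_len ps | ps. is_path T p ps q}" for p q
  have d: "tree_dist T p q = Inf (L p q)" if "p \<in> points T" "q \<in> points T" for p q
    using that by (simp add: tree_dist_def L_def)
  have bdd: "bdd_below (L p q)" for p q
    by (rule bdd_belowI[of _ 0]) (auto simp: L_def path_len_nonneg)
  have ne: "L p q \<noteq> {}" if "p \<in> points T" "q \<in> points T" for p q
    using path_exists[OF that] by (auto simp: L_def)
  have sym: "L p q = L q p" for p q
    using path_rev path_len_rev unfolding L_def by (metis (no_types, opaque_lifting))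
  fix p q r
  show "0 \<le> tree_dist T p q"
    using ne[of p q] by (auto simp: tree_dist_def path_len_nonneg L_def intro!: cInf_greatest)
  show "tree_dist T p q = tree_dist T q p"
    using sym[of p q] by (auto simp: tree_dist_def L_def)
  show "tree_dist T p q = 0 \<longleftrightarrow> p = q" if pq: "p \<in> points T" "q \<in> points T"
  proof
    assume "p = q"
    then have "is_path T p [p] q" by (simp add: is_path_def)
    then have "0 \<in> L p q" by (force simp: L_def)
    then have "Inf (L p q) \<le> 0" using bdd cInf_lower by blast
    moreover have "0 \<le> Inf (L p q)"
      using ne[OF pq] by (intro cInf_greatest) (auto simp: L_def path_len_nonneg)
    ultimately show "tree_dist T p q = 0" using d[OF pq] by simp
  next
    assume 0: "tree_dist T p q = 0"
    show "p = q"
    proof (rule ccontr)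
      assume "p \<noteq> q"
      then obtain e where e: "e > 0" "\<And>ps. is_path T p ps q \<Longrightarrow> e \<le> path_len ps"
        using separated pq by blast
      have "e \<le> Inf (L p q)" using ne[OF pq] e(2) by (intro cInf_greatest) (auto simp: L_def)
      then show False using e(1) 0 d[OF pq] by simp
    qed
  qed
  show "tree_dist T p r \<le> tree_dist T p q + tree_dist T q r"
    if pts: "p \<in> points T" "q \<in> points T" "r \<in> points T"
  proof -
    have *: "Inf (L p r) \<le> a + b" if "a \<in> L p q" "b \<in> L q r" for a b
    proof -
      have "a + b \<in> L p r" using that path_append unfolding L_def mem_Collect_eq by metis
      then show ?thesis using bdd cInf_lower by blast
    qed
    have "Inf (L p r) - a \<le> Inf (L q r)" if "a \<in> L p q" for a
      using ne[OF pts(2,3)] *[OF that] by (intro cInf_greatest) (auto simp: diff_le_eq add.commute)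
    then have "Inf (L p r) - Inf (L q r) \<le> Inf (L p q)"
      using ne[OF pts(1,2)] by (intro cInf_greatest) (auto simp: algebra_simps)
    then show ?thesis using d pts by simp
  qed
qed

end



section \<open>Good maps\<close>

text \<open>
  In the last clause the least element exists: by the first two clauses the image of a
  continuous map is a finite union of sets \<open>{y'. ple G y y'}\<close>, one for each leaf of \<open>T\<close>.
\<close>

definition good_map ::
  "'v mtree \<Rightarrow> 'w mtree \<Rightarrow> real \<Rightarrow> ('v \<times> real \<Rightarrow> 'w \<times> real) \<Rightarrow> bool" where
  "good_map T G \<epsilon> \<alpha> \<longleftrightarrow>
     continuous_map (tree_topology T) (tree_topology G) \<alpha> \<and>
     (\<forall>x\<in>points T. pheight (\<alpha> x) = pheight x + \<epsilon>) \<and>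
     (\<forall>x\<in>points T. \<forall>x'\<in>points T. pless G (\<alpha> x) (\<alpha> x') \<longrightarrow>
        pless T (shift T (2 * \<epsilon>) x) (shift T (2 * \<epsilon>) x')) \<and>
     (\<forall>y\<in>points G - \<alpha> ` points T.
        pheight (least_in (ple G) {y' \<in> \<alpha> ` points T. pless G y y'}) - pheight y \<le> 2 * \<epsilon>)"


section \<open>Couplings\<close>

text \<open>
  In this and the next section \<open>A\<close> stands for the projection of a coupling \<open>C\<close> to the vertices
  of \<open>T\<close>. The projections of \<open>C\<close> to the two trees are \<open>Domain C\<close> and \<open>Range C\<close>.
\<close>

definition Lam :: "'v mtree \<Rightarrow> 'v set \<Rightarrow> 'v \<Rightarrow> 'v set" where
  "Lam T A v = {a \<in> A. vless T a v \<and> \<not> (\<exists>a'\<in>A. vless T a' v \<and> vless T a a')}"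

definition unused :: "'v mtree \<Rightarrow> 'v set \<Rightarrow> 'v set" where
  "unused T A = {v \<in> verts T. card (Lam T A v) = 1}"

definition coupling_max ::
  "'v mtree \<Rightarrow> 'w mtree \<Rightarrow> ('v \<times> 'w) set \<Rightarrow> ('v \<times> 'w) set" where
  "coupling_max T G C =
     {(a, b) \<in> C. \<not> (\<exists>(c, d)\<in>C. vless T a c \<and> vless G b d)}"

definition coupling ::
  "'v mtree \<Rightarrow> 'w mtree \<Rightarrow> ('v \<times> 'w) set \<Rightarrow> bool" where
  "coupling T G C \<longleftrightarrow>
     C \<subseteq> verts T \<times> verts G \<and>
     card (coupling_max T G C) = 1 \<and>
     inj_on fst C \<and> inj_on snd C \<and>
     (\<forall>(a, b)\<in>C. \<forall>(c, d)\<in>C. vless T a c \<longleftrightarrow> vless G b d) \<and>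
     (\<forall>a\<in>Domain C. card (Lam T (Domain C) a) \<noteq> 1) \<and>
     (\<forall>b\<in>Range C. card (Lam G (Range C) b) \<noteq> 1)"


section \<open>The vertex maps and the cost of a coupling\<close>

definition phi :: "'v mtree \<Rightarrow> 'v set \<Rightarrow> 'v \<Rightarrow> 'v" where
  "phi T A x = least_in (vle T) {v \<in> verts T. vless T x v \<and> (\<exists>v'\<in>A. vle T v' v)}"

definition eta ::
  "'v mtree \<Rightarrow> 'w mtree \<Rightarrow> ('v \<times> 'w) set \<Rightarrow> 'v \<Rightarrow> 'w" where
  "eta T G C x = arg_min_on (height G) {w. \<exists>v. (v, w) \<in> C \<and> vle T v (phi T (Domain C) x)}"

definition chi ::
  "'v mtree \<Rightarrow> 'w mtree \<Rightarrow> ('v \<times> 'w) set \<Rightarrow> 'v \<Rightarrow> 'w" where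
  "chi T G C x = LCA G {w. \<exists>v. (v, w) \<in> C \<and> v \<in> Lam T (Domain C) x}"

text \<open>
  \<open>vertex_map T G C\<close> is $\alpha_C$ and \<open>vertex_map G T (C\<inverse>)\<close> is $\beta_C$. Only the values at the vertices
  outside of \<open>unused T (Domain C)\<close> are meaningful. Such a vertex either belongs to \<open>Domain C\<close>
  or is a deleted vertex, in which case \<open>Lam T (Domain C) x\<close> is empty or has at least two elements.
\<close>

definition vertex_map ::
  "'v mtree \<Rightarrow> 'w mtree \<Rightarrow> ('v \<times> 'w) set \<Rightarrow> 'v \<Rightarrow> 'w \<times> real" where
  "vertex_map T G C x =
     (if x \<in> Domain C then pt G (THE y. (x, y) \<in> C)
      else if Lam T (Domain C) x = {} then
        point_above G (pt G (eta T G C x))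
          (max (height G (eta T G C x)) ((height T x + height T (phi T (Domain C) x)) / 2))
      else pt G (chi T G C x))"

definition half_cost ::
  "'v mtree \<Rightarrow> 'w mtree \<Rightarrow> ('v \<times> 'w) set \<Rightarrow> real" where
  "half_cost T G C = Max ((\<lambda>x. \<bar>pheight (vertex_map T G C x) - height T x\<bar>) `
     (verts T - unused T (Domain C)))"

definition coupling_cost ::
  "'v mtree \<Rightarrow> 'w mtree \<Rightarrow> ('v \<times> 'w) set \<Rightarrow> real" where
  "coupling_cost T G C = max (half_cost T G C) (half_cost G T (C\<inverse>))"

end

theory Submission
  imports Defs
begin

text \<open>
  An \<open>\<epsilon>\<close>-good map \<open>\<alpha>\<close> preserves the order (\<open>good_map_mono\<close>, by continuity) and has a partner
  \<open>\<beta>\<close> in the other direction, also monotone and raising heights by \<open>\<epsilon>\<close>, such that \<open>x\<close> is below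
  \<open>\<beta> (\<alpha> x)\<close> and \<open>y\<close> is below \<open>\<alpha> (\<beta> y)\<close> (\<open>ex_interleaving\<close>). What remains is combinatorics of such an
  interleaving.

  Call leaves \<open>x\<close> of \<open>T\<close> and \<open>y\<close> of \<open>G\<close> compatible if \<open>y\<close> is below \<open>\<alpha> x\<close> and \<open>x\<close> is below \<open>\<beta> y\<close>. If
  compatible leaves are matched, then \<open>\<alpha>\<close> and \<open>\<beta>\<close> transport common upper bounds of matched leaves, so the
  least common ancestors of a set of matched leaves and of the set of their partners differ in
  height by at most \<open>\<epsilon>\<close>. A coupling with small cost arises from a matching of compatible leaves
  by adding, for every set of matches that is cut out by a vertex in both trees, the two least common
  ancestors (\<open>cluster_coupling\<close>). A vertex above at least two matched leaves is then either
  coupled, or unused, or its set of matched leaves is not cut out in the other tree, and then the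
  least common ancestor there sees an additional leaf, which bounds the cost (\<open>deleted_with_matches\<close>).

  A vertex \<open>x\<close> above no matched leaf has to merge with a matched leaf within \<open>2 * \<epsilon>\<close>, and among the
  matches below the merging point one must have its second leaf not above \<open>height T x + \<epsilon>\<close>. Both hold
  (\<open>deleted_without_matches\<close>) if the matching covers the persistent leaves, those which are lowest
  below their own shift by \<open>2 * \<epsilon>\<close>, in both trees and if every match involves a persistent leaf.

  To find such a matching, \<open>\<alpha>\<close> and \<open>\<beta>\<close> are modified such that every persistent leaf of either
  tree is compatible with a leaf of the other one (\<open>ex_adapted_to_both\<close>). Distinct persistent leaves
  of one tree are never compatible with the same leaf (\<open>compatible_inj\<close>), so there is an injective choice of
  partners for each tree, and the two choices combine to a single matching as in the
  Schroeder-Bernstein theorem (\<open>ex_matching_covering_both\<close>).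
\<close>

section \<open>The order on the points of a metric merge tree\<close>

definition leaf :: "'v mtree \<Rightarrow> 'v \<Rightarrow> bool" where
  "leaf T x \<longleftrightarrow> x \<in> verts T \<and> (\<forall>u\<in>verts T. vle T u x \<longrightarrow> u = x)"

context merge_tree
begin

lemma vle_antisym: "vle T x y \<Longrightarrow> vle T y x \<Longrightarrow> x \<in> verts T \<Longrightarrow> x = y"
  using height_mono[of x y] vle_height[of y x] vle_in[of x y] by (force simp: vless_def)

lemma points_fst: "p \<in> points T \<Longrightarrow> fst p \<in> verts T"
  and points_height: "p \<in> points T \<Longrightarrow> height T (fst p) \<le> pheight p"
  and points_father: "p \<in> points T \<Longrightarrow> (fst p, z) \<in> edges T \<Longrightarrow> pheight p < height T z"
  by (auto simp: points_def pheight_def)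

lemma pheight_pt [simp]: "pheight (pt T x) = height T x"
  and fst_pt [simp]: "fst (pt T x) = x"
  by (simp_all add: pheight_def pt_def)

lemma points_eqI: "fst p = fst q \<Longrightarrow> pheight p = pheight q \<Longrightarrow> p = q"
  by (simp add: pheight_def prod_eq_iff)

lemma ple_refl: "ple T p p"
  by (simp add: ple_def vle_refl)

lemma ple_trans: "ple T p q \<Longrightarrow> ple T q r \<Longrightarrow> ple T p r"
  using vle_trans[of "fst p" "fst q" "fst r"] by (simp add: ple_def)

lemma ple_antisym: "ple T p q \<Longrightarrow> ple T q p \<Longrightarrow> p \<in> points T \<Longrightarrow> p = q"
  using points_fst[of p] vle_antisym[of "fst p" "fst q"] by (auto simp: ple_def intro!: points_eqI)

lemma ple_pheight: "ple T p q \<Longrightarrow> pheight p \<le> pheight q"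
  by (simp add: ple_def)

lemma ple_pt: "x \<in> verts T \<Longrightarrow> q \<in> points T \<Longrightarrow> ple T (pt T x) q \<longleftrightarrow> vle T x (fst q)"
  using vle_height[of x "fst q"] points_height[of q] by (auto simp: ple_def)

lemma ple_pt_fst: "p \<in> points T \<Longrightarrow> ple T (pt T (fst p)) p"
  by (simp add: ple_pt points_fst vle_refl)

text \<open>Going up from \<open>fst p\<close> to another vertex means leaving the edge that carries \<open>p\<close>.\<close>

lemma points_below_vertex:
  assumes "p \<in> points T" "vle T (fst p) v" "fst p \<noteq> v"
  shows "pheight p < height T v"
proof -
  obtain z where z: "(fst p, z) \<in> edges T" "vle T z v" using vle_cases assms by blast
  then show ?thesis using points_father[OF assms(1) z(1)] vle_height[OF z(2)] edges_in by fastforce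
qed

lemma ple_chain:
  assumes "q \<in> points T" "r \<in> points T" "ple T p q" "ple T p r" "pheight q \<le> pheight r"
  shows "ple T q r"
proof -
  have "vle T (fst q) (fst r)"
  proof (rule ccontr)
    assume n: "\<not> vle T (fst q) (fst r)"
    then have "vle T (fst r) (fst q)" "fst r \<noteq> fst q"
      using vle_chain assms(3,4) vle_refl by (auto simp: ple_def)
    then have "pheight r < height T (fst q)" using points_below_vertex assms(2) by blast
    then show False using points_height[OF assms(1)] assms(5) by simp
  qed
  then show ?thesis using assms(5) by (simp add: ple_def)
qed

lemma ple_linear:
  "q \<in> points T \<Longrightarrow> r \<in> points T \<Longrightarrow> ple T p q \<Longrightarrow> ple T p r \<Longrightarrow> ple T q r \<or> ple T r q"
  using ple_chain by (meson linorder_le_cases)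

lemma
  assumes "p \<in> points T" "pheight p \<le> h"
  shows above_in: "point_above T p h \<in> points T"
    and above_ple: "ple T p (point_above T p h)"
    and pheight_above: "pheight (point_above T p h) = h"
  using theI'[OF point_above_ex1[OF assms]] by (simp_all add: point_above_def)

lemma above_eq: "p \<in> points T \<Longrightarrow> q \<in> points T \<Longrightarrow> ple T p q \<Longrightarrow> pheight q = h \<Longrightarrow> point_above T p h = q"
  by (rule up_unique[of _ _ p]) (auto simp: above_in above_ple pheight_above dest: ple_pheight)

lemma
  assumes "p \<in> points T" "0 \<le> k"
  shows shift_in: "shift T k p \<in> points T"
    and shift_ple: "ple T p (shift T k p)"
    and pheight_shift: "pheight (shift T k p) = pheight p + k"
  using above_in[OF assms(1)] above_ple[OF assms(1)] pheight_above[OF assms(1)] assms(2)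
  by (simp_all add: shift_def)

lemma ple_point_above:
  assumes "p \<in> points T" "pheight p \<le> h" "r \<in> points T" "ple T p r" "h \<le> pheight r"
  shows "ple T (point_above T p h) r"
  by (rule ple_chain[of _ _ p]) (use assms in \<open>auto simp: above_in above_ple pheight_above\<close>)

lemma point_above_ple:
  assumes "p \<in> points T" "pheight p \<le> h" "r \<in> points T" "ple T p r" "pheight r \<le> h"
  shows "ple T r (point_above T p h)"
  by (rule ple_chain[of _ _ p]) (use assms in \<open>auto simp: above_in above_ple pheight_above\<close>)

lemma least_in_chain:
  assumes "A \<subseteq> {v \<in> verts T. vle T x v}" "A \<noteq> {}"
  shows "least_in (vle T) A \<in> A" and "\<And>a. a \<in> A \<Longrightarrow> vle T (least_in (vle T) A) a"
proof -
  have fin: "finite A" using assms(1) finite_verts by (auto intro: finite_subset)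
  obtain m where m: "m \<in> A" "\<And>a. a \<in> A \<Longrightarrow> height T m \<le> height T a"
    using ex_is_arg_min_if_finite[OF fin assms(2), of "height T"] by (auto simp: is_arg_min_linorder)
  have le: "vle T m a" if "a \<in> A" for a
  proof -
    have "vle T m a \<or> vle T a m" using assms(1) that m(1) vle_chain by blast
    moreover have "m = a" if "vle T a m"
    proof -
      have "height T a \<le> height T m" using vle_height[OF that] assms(1) \<open>a \<in> A\<close> by auto
      then show ?thesis using m \<open>a \<in> A\<close> assms(1) height_inj
        by (metis (mono_tags, lifting) inj_onD mem_Collect_eq order_antisym subsetD)
    qed
    ultimately show ?thesis using vle_refl by blast
  qed
  have "\<exists>!m. m \<in> A \<and> (\<forall>a\<in>A. vle T m a)"
    using m(1) le vle_antisym assms(1) by (intro ex1I[of _ m]) auto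
  from theI'[OF this]
  show "least_in (vle T) A \<in> A" "\<And>a. a \<in> A \<Longrightarrow> vle T (least_in (vle T) A) a"
    by (auto simp: least_in_def)
qed

lemma
  assumes "S \<subseteq> verts T" "S \<noteq> {}"
  shows LCA_in: "LCA T S \<in> verts T"
    and LCA_upper: "\<And>s. s \<in> S \<Longrightarrow> vle T s (LCA T S)"
    and LCA_least: "\<And>u. u \<in> verts T \<Longrightarrow> (\<And>s. s \<in> S \<Longrightarrow> vle T s u) \<Longrightarrow> vle T (LCA T S) u"
proof -
  let ?U = "{u \<in> verts T. \<forall>s\<in>S. vle T s u}"
  obtain s where "s \<in> S" using assms(2) by blast
  then have U: "?U \<subseteq> {v \<in> verts T. vle T s v}" "?U \<noteq> {}"
    using root_in below_root assms(1) by auto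
  have "LCA T S \<in> ?U" unfolding LCA_def by (rule least_in_chain[OF U])
  then show "LCA T S \<in> verts T" "\<And>s. s \<in> S \<Longrightarrow> vle T s (LCA T S)" by auto
  show "vle T (LCA T S) u" if "u \<in> verts T" "\<And>s. s \<in> S \<Longrightarrow> vle T s u" for u
    unfolding LCA_def by (rule least_in_chain[OF U]) (use that in auto)
qed

text \<open>Two points have a least upper bound: it lies on the edge above the least common ancestor
  of the vertices that carry them, and is the highest of that vertex and the two points.\<close>

lemma point_join:
  assumes p: "p \<in> points T" and q: "q \<in> points T"
  obtains j where "j \<in> points T" "ple T p j" "ple T q j"
    "\<And>u. u \<in> points T \<Longrightarrow> ple T p u \<Longrightarrow> ple T q u \<Longrightarrow> ple T j u"
proof -
  define w where "w = LCA T {fst p, fst q}"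
  define j where "j = (w, max (height T w) (max (pheight p) (pheight q)))"
  have w: "w \<in> verts T" "vle T (fst p) w" "vle T (fst q) w"
    "\<And>u. u \<in> verts T \<Longrightarrow> vle T (fst p) u \<Longrightarrow> vle T (fst q) u \<Longrightarrow> vle T w u"
    using LCA_in[of "{fst p, fst q}"] LCA_upper[of "{fst p, fst q}"] LCA_least[of "{fst p, fst q}"]
      points_fst p q unfolding w_def by auto
  have *: "pheight r < height T z"
    if "(w, z) \<in> edges T" "r \<in> points T" "vle T (fst r) w" for r z
    using that points_below_vertex[of r w] points_father[of r z] edge_height[OF that(1)] by fastforce
  have "j \<in> points T"
    using w *[OF _ p] *[OF _ q] edge_height[of w] by (auto simp: points_def j_def)
  moreover have "ple T p j" "ple T q j" using w by (auto simp: ple_def j_def pheight_def)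
  moreover have "ple T j u" if "u \<in> points T" "ple T p u" "ple T q u" for u
  proof -
    have wu: "vle T w (fst u)" using w(4)[OF points_fst] that by (auto simp: ple_def)
    have "height T w \<le> pheight u"
      using vle_height[OF wu w(1)] points_height[OF that(1)] by simp
    then show ?thesis using wu that by (simp add: ple_def j_def pheight_def)
  qed
  ultimately show ?thesis using that by blast
qed

lemma leaf_below:
  assumes "p \<in> points T"
  obtains l where "leaf T l" "ple T (pt T l) p"
proof -
  let ?A = "{v \<in> verts T. vle T v (fst p)}"
  have "finite ?A" "?A \<noteq> {}" using finite_verts points_fst[OF assms] vle_refl by auto
  then obtain l where l: "l \<in> ?A" "\<And>u. u \<in> ?A \<Longrightarrow> height T l \<le> height T u"
    using ex_is_arg_min_if_finite[of ?A "height T"] unfolding is_arg_min_linorder by blast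
  have "u = l" if "u \<in> verts T" "vle T u l" for u
  proof -
    have "u \<in> ?A" using that l vle_trans by blast
    then have "height T u = height T l"
      using l(2) vle_height[OF that(2,1)] by fastforce
    then show ?thesis using height_inj that l by (auto dest: inj_onD)
  qed
  then have "leaf T l" using l by (auto simp: leaf_def)
  then show ?thesis using that l(1) ple_pt assms by blast
qed

end

section \<open>Good maps preserve the order\<close>

context merge_tree
begin

lemma increasing_path:
  assumes "ple T a b" "a \<in> points T" "b \<in> points T"
  shows "\<exists>ps. is_path T a ps b \<and> path_len ps = pheight b - pheight a"
proof -
  have "vle T (fst a) (fst b)" using assms(1) by (simp add: ple_def)
  then show ?thesis
    using assms unfolding vle_def
  proof (induction "fst a" arbitrary: a rule: converse_rtrancl_induct)
    case base
    then have "is_path T a [a, b] b"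
      using points_fst[of b] by (auto simp: is_path_def segment_def)
    then show ?case using ple_pheight[OF base(2)] by (intro exI[of _ "[a, b]"]) simp
  next
    case (step z)
    have z: "z \<in> verts T" "vle T z (fst b)" using step edges_in by (auto simp: vle_def)
    have "ple T (pt T z) b" using ple_pt z step.prems by blast
    then obtain ps where ps: "is_path T (pt T z) ps b" "path_len ps = pheight b - height T z"
      using step.hyps(3)[of "pt T z"] step.prems pt_in[OF z(1)] by auto
    then obtain qs where qs: "ps = pt T z # qs" by (cases ps) (auto simp: is_path_def)
    have "is_path T a (a # ps) b"
      using ps(1) step points_fst[of a] unfolding qs is_path_Cons2 by (auto simp: segment_def)
    moreover have "pheight a < height T z" using points_father step by blast
    ultimately show ?case using ps(2) qs by (intro exI[of _ "a # ps"]) simp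
  qed
qed

lemma tree_dist_le:
  assumes "ple T a b" "a \<in> points T" "b \<in> points T"
  shows "tree_dist T a b \<le> pheight b - pheight a"
proof -
  obtain ps where ps: "is_path T a ps b" "path_len ps = pheight b - pheight a"
    using increasing_path[OF assms] by blast
  have "bdd_below {path_len ps | ps. is_path T a ps b}"
    by (rule bdd_belowI[of _ 0]) (auto simp: path_len_nonneg)
  then have "Inf {path_len ps | ps. is_path T a ps b} \<le> path_len ps"
    using ps(1) by (intro cInf_lower) auto
  then show ?thesis using ps(2) assms by (simp add: tree_dist_def)
qed

text \<open>A point incomparable to \<open>p\<close> can be reached from \<open>p\<close> only through the father \<open>z\<close> of the vertex
  carrying \<open>p\<close>. The function \<open>F\<close> below, the depth under \<open>z\<close> in the branch of \<open>p\<close>, bounds the length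
  of such a path from below.\<close>

lemma near_points_comparable:
  assumes p: "p \<in> points T"
  shows "\<exists>r>0. \<forall>q\<in>points T. tree_dist T p q < r \<longrightarrow> ple T p q \<or> ple T q p"
proof -
  have comp: "ple T p q \<or> ple T q p" if q: "q \<in> points T" "vle T (fst q) (fst p)" for q
  proof (cases "fst q = fst p")
    case True
    then show ?thesis using vle_refl by (auto simp: ple_def)
  next
    case False
    then have "pheight q < height T (fst p)" using points_below_vertex q by blast
    then show ?thesis using q points_height[OF p] by (simp add: ple_def)
  qed
  show ?thesis
  proof (cases "fst p = root T")
    case True
    then show ?thesis using comp below_root points_fst by (intro exI[of _ 1]) auto
  next
    case False
    then obtain z where z: "(fst p, z) \<in> edges T" using unique_father points_fst[OF p] by blast
    define F where "F a = (if vle T (fst a) (fst p) then height T z - pheight a else 0)" for a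
    have lip: "\<bar>F a - F b\<bar> \<le> \<bar>pheight a - pheight b\<bar>"
      if ab: "x \<in> verts T" "a \<in> segment T x" "b \<in> segment T x" for x a b
    proof -
      have *: "F c = (if vle T x (fst p) then height T z - pheight c else 0)"
        if c: "c \<in> segment T x" for c
      proof (cases "fst c = x")
        case True then show ?thesis by (simp add: F_def)
      next
        case False
        then obtain y where y: "c = pt T y" "(x, y) \<in> edges T" using c by (auto simp: segment_def)
        show ?thesis
        proof (cases "x = fst p")
          case True
          then have "y = z" using y z father_eq by blast
          then have "\<not> vle T y (fst p)"
            using vle_height[of z "fst p"] edge_height[OF z] z edges_in by force
          then show ?thesis using True y \<open>y = z\<close> by (simp add: F_def vle_refl)
        next
          case False
          then have "vle T y (fst p) \<longleftrightarrow> vle T x (fst p)"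
            using y(2) vle_cases father_eq by (metis vle_def converse_rtrancl_into_rtrancl)
          then show ?thesis using y by (simp add: F_def)
        qed
      qed
      show ?thesis using *[OF ab(2)] *[OF ab(3)] by auto
    qed
    have Fp: "F p = height T z - pheight p" by (simp add: F_def vle_refl)
    have "F p \<le> tree_dist T p q" if q: "q \<in> points T" "\<not> vle T (fst q) (fst p)" for q
    proof -
      have "F p \<le> path_len ps" if "is_path T p ps q" for ps
      proof -
        have "\<bar>F p - F q\<bar> \<le> path_len ps" by (rule path_len_Lipschitz[OF _ that]) (rule lip)
        moreover have "F q = 0" using q(2) by (simp add: F_def)
        ultimately show ?thesis by simp
      qed
      then show ?thesis
        using p q(1) path_exists[OF p q(1)] by (auto simp: tree_dist_def intro!: cInf_greatest)
    qed
    moreover have "F p > 0" using points_father[OF p z] Fp by simp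
    ultimately show ?thesis using comp by (intro exI[of _ "F p"]) (meson not_less)
  qed
qed

end

lemma good_map_points:
  assumes "merge_tree T" "merge_tree G" "good_map T G \<epsilon> \<alpha>" "p \<in> points T"
  shows "\<alpha> p \<in> points G"
proof -
  have "continuous_map (tree_topology T) (tree_topology G) \<alpha>"
    using assms(3) by (simp add: good_map_def)
  moreover have "topspace (tree_topology T) = points T" "topspace (tree_topology G) = points G"
    by (simp_all add: tree_topology_def assms merge_tree.Metric_space_tree_dist
        Metric_space.topspace_mtopology)
  ultimately show ?thesis
    using continuous_map_image_subset_topspace assms(4) by blast
qed

text \<open>Along an ascending path the height of the image increases, and the image moves continuously,
  so for a short while it stays comparable to where it was. Hence it ascends for a short while, and
  the Bolzano induction principle on compact intervals extends this to the whole path.\<close>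

lemma good_map_mono:
  assumes T: "merge_tree T" and G: "merge_tree G" and good: "good_map T G \<epsilon> \<alpha>"
    and p: "p \<in> points T" and q: "q \<in> points T" and le: "ple T p q"
  shows "ple G (\<alpha> p) (\<alpha> q)"
proof -
  interpret T: merge_tree T by (rule T)
  interpret G: merge_tree G by (rule G)
  interpret MT: Metric_space "points T" "tree_dist T" by (rule T.Metric_space_tree_dist)
  note in_G = good_map_points[OF T G good]
  have h: "pheight (\<alpha> x) = pheight x + \<epsilon>" if "x \<in> points T" for x
    using good that by (simp add: good_map_def)
  define \<gamma> where "\<gamma> t = point_above T p (max t (pheight p))" for t
  have \<gamma>: "\<gamma> t \<in> points T" "ple T p (\<gamma> t)" "pheight (\<gamma> t) = max t (pheight p)" for t
    by (simp_all add: \<gamma>_def T.above_in T.above_ple T.pheight_above p)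
  have mono: "ple T (\<gamma> s) (\<gamma> t)" if "s \<le> t" for s t
    by (rule T.ple_chain[of "\<gamma> s" "\<gamma> t" p]) (use \<gamma> that in auto)
  have "ple G (\<alpha> (\<gamma> (pheight p))) (\<alpha> (\<gamma> (pheight q)))"
    using T.ple_pheight[OF le]
  proof (induction rule: Bolzano)
    case (trans a b c)
    then show ?case using G.ple_trans by blast
  next
    case (local t)
    obtain r where r: "r > 0"
      "\<And>y. y \<in> points G \<Longrightarrow> tree_dist G (\<alpha> (\<gamma> t)) y < r \<Longrightarrow> ple G (\<alpha> (\<gamma> t)) y \<or> ple G y (\<alpha> (\<gamma> t))"
      using G.near_points_comparable[OF in_G[OF \<gamma>(1)]] by blast
    have "continuous_map MT.mtopology (Metric_space.mtopology (points G) (tree_dist G)) \<alpha>"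
      using good by (simp add: good_map_def tree_topology_def)
    then obtain d where d: "d > 0"
      "\<And>x. x \<in> points T \<Longrightarrow> tree_dist T (\<gamma> t) x < d \<Longrightarrow> tree_dist G (\<alpha> (\<gamma> t)) (\<alpha> x) < r"
      unfolding MT.metric_continuous_map[OF G.Metric_space_tree_dist] using \<gamma>(1) r(1) by meson
    have near: "ple G (\<alpha> (\<gamma> t)) (\<alpha> (\<gamma> s)) \<or> ple G (\<alpha> (\<gamma> s)) (\<alpha> (\<gamma> t))" if "\<bar>s - t\<bar> < d" for s
    proof -
      have "tree_dist T (\<gamma> t) (\<gamma> s) \<le> \<bar>s - t\<bar>"
      proof (cases "s \<le> t")
        case True
        then have "tree_dist T (\<gamma> s) (\<gamma> t) \<le> pheight (\<gamma> t) - pheight (\<gamma> s)"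
          using T.tree_dist_le mono \<gamma>(1) by blast
        then show ?thesis using True \<gamma>(3) MT.commute[of "\<gamma> s" "\<gamma> t"] by simp
      next
        case False
        then have "tree_dist T (\<gamma> t) (\<gamma> s) \<le> pheight (\<gamma> s) - pheight (\<gamma> t)"
          using T.tree_dist_le mono \<gamma>(1) by simp
        then show ?thesis using False \<gamma>(3) by simp
      qed
      then have "tree_dist T (\<gamma> t) (\<gamma> s) < d" using that by simp
      then show ?thesis using r(2)[OF in_G[OF \<gamma>(1)] d(2)[OF \<gamma>(1)]] by simp
    qed
    have up: "ple G (\<alpha> (\<gamma> s)) (\<alpha> (\<gamma> u))"
      if su: "s \<le> u" "ple G (\<alpha> (\<gamma> s)) (\<alpha> (\<gamma> u)) \<or> ple G (\<alpha> (\<gamma> u)) (\<alpha> (\<gamma> s))" for s u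
    proof -
      have "pheight (\<alpha> (\<gamma> s)) \<le> pheight (\<alpha> (\<gamma> u))"
        using su h[OF \<gamma>(1)] \<gamma>(3) by simp
      then show ?thesis
        using su(2) G.ple_refl G.ple_chain[OF in_G[OF \<gamma>(1)] in_G[OF \<gamma>(1)]] by blast
    qed
    show ?case
    proof (intro exI[of _ d] conjI allI impI)
      fix a b assume ab: "a \<le> t \<and> t \<le> b \<and> b - a < d"
      have "ple G (\<alpha> (\<gamma> a)) (\<alpha> (\<gamma> t))" using ab near[of a] by (intro up) auto
      moreover have "ple G (\<alpha> (\<gamma> t)) (\<alpha> (\<gamma> b))" using ab near[of b] by (intro up) auto
      ultimately show "ple G (\<alpha> (\<gamma> a)) (\<alpha> (\<gamma> b))" using G.ple_trans by blast
    qed (rule d)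
  qed
  moreover have "\<gamma> (pheight p) = p" "\<gamma> (pheight q) = q"
    using T.above_eq[OF p] p q le T.ple_refl T.ple_pheight[OF le] by (simp_all add: \<gamma>_def)
  ultimately show ?thesis by simp
qed

section \<open>From a good map to an interleaving\<close>

locale interleaving = T: merge_tree T + G: merge_tree G
  for T :: "'v mtree" and G :: "'w mtree" +
  fixes \<epsilon> :: real and \<alpha> :: "'v \<times> real \<Rightarrow> 'w \<times> real" and \<beta> :: "'w \<times> real \<Rightarrow> 'v \<times> real"
  assumes eps: "\<epsilon> \<ge> 0"
    and \<alpha>_in: "p \<in> points T \<Longrightarrow> \<alpha> p \<in> points G"
    and \<beta>_in: "q \<in> points G \<Longrightarrow> \<beta> q \<in> points T"
    and \<alpha>_height: "p \<in> points T \<Longrightarrow> pheight (\<alpha> p) = pheight p + \<epsilon>"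
    and \<beta>_height: "q \<in> points G \<Longrightarrow> pheight (\<beta> q) = pheight q + \<epsilon>"
    and \<alpha>_mono: "p \<in> points T \<Longrightarrow> p' \<in> points T \<Longrightarrow> ple T p p' \<Longrightarrow> ple G (\<alpha> p) (\<alpha> p')"
    and \<beta>_mono: "q \<in> points G \<Longrightarrow> q' \<in> points G \<Longrightarrow> ple G q q' \<Longrightarrow> ple T (\<beta> q) (\<beta> q')"
    and \<beta>\<alpha>_ge: "p \<in> points T \<Longrightarrow> ple T p (\<beta> (\<alpha> p))"
    and \<alpha>\<beta>_ge: "q \<in> points G \<Longrightarrow> ple G q (\<alpha> (\<beta> q))"

lemma interleaving_swap: "interleaving T G \<epsilon> \<alpha> \<beta> \<Longrightarrow> interleaving G T \<epsilon> \<beta> \<alpha>"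
  unfolding interleaving_def interleaving_axioms_def by blast

locale good_map_between = T: merge_tree T + G: merge_tree G
  for T :: "'v mtree" and G :: "'w mtree" +
  fixes \<epsilon> :: real and \<alpha> :: "'v \<times> real \<Rightarrow> 'w \<times> real"
  assumes eps: "\<epsilon> \<ge> 0" and good: "good_map T G \<epsilon> \<alpha>"
begin

lemma \<alpha>_in: "p \<in> points T \<Longrightarrow> \<alpha> p \<in> points G"
  using good_map_points[OF T.merge_tree_axioms G.merge_tree_axioms good] .

lemma \<alpha>_mono: "p \<in> points T \<Longrightarrow> p' \<in> points T \<Longrightarrow> ple T p p' \<Longrightarrow> ple G (\<alpha> p) (\<alpha> p')"
  using good_map_mono[OF T.merge_tree_axioms G.merge_tree_axioms good] .

lemma \<alpha>_height: "p \<in> points T \<Longrightarrow> pheight (\<alpha> p) = pheight p + \<epsilon>"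
  using good by (simp add: good_map_def)

lemma shift_less:
  "p \<in> points T \<Longrightarrow> p' \<in> points T \<Longrightarrow> pless G (\<alpha> p) (\<alpha> p') \<Longrightarrow>
     pless T (shift T (2 * \<epsilon>) p) (shift T (2 * \<epsilon>) p')"
  using good by (simp add: good_map_def)

lemma image_upward_closed:
  assumes p: "p \<in> points T" and q: "q \<in> points G" and le: "ple G (\<alpha> p) q"
  shows "q \<in> \<alpha> ` points T"
proof -
  let ?r = "point_above T p (pheight q - \<epsilon>)"
  have h: "pheight p \<le> pheight q - \<epsilon>" using G.ple_pheight[OF le] \<alpha>_height[OF p] by simp
  have "\<alpha> ?r = q"
    using \<alpha>_mono[OF p T.above_in[OF p h] T.above_ple[OF p h]] le q
      \<alpha>_in[OF T.above_in[OF p h]] \<alpha>_height[OF T.above_in[OF p h]] T.pheight_above[OF p h]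
    by (intro G.up_unique[of _ _ "\<alpha> p"]) auto
  then show ?thesis using T.above_in[OF p h] by (intro image_eqI) auto
qed

text \<open>The strict inequality in the definition of good maps passes to the limit: two points with
  the same image coincide after the shift by \<open>2 * \<epsilon>\<close>, because their further shifts by any small
  \<open>k > 0\<close> are comparable, and a short shift stays on the same edge.\<close>

lemma shift_eq:
  assumes p: "p \<in> points T" and p': "p' \<in> points T" and eq: "\<alpha> p = \<alpha> p'"
  shows "shift T (2 * \<epsilon>) p = shift T (2 * \<epsilon>) p'"
proof -
  define u u' where "u = shift T (2 * \<epsilon>) p" and "u' = shift T (2 * \<epsilon>) p'"
  have u: "u \<in> points T" "pheight u = pheight p + 2 * \<epsilon>"
    and u': "u' \<in> points T" "pheight u' = pheight p' + 2 * \<epsilon>" "ple T p' u'"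
    using p p' eps T.shift_in T.pheight_shift T.shift_ple by (auto simp: u_def u'_def)
  have h: "pheight p = pheight p'" using \<alpha>_height[OF p] \<alpha>_height[OF p'] eq by simp
  have "\<exists>k>0. (fst u', pheight u' + k) \<in> points T"
  proof (cases "fst u' = root T")
    case True
    have "height T (root T) \<le> pheight u'" using T.points_height[OF u'(1)] True by simp
    then show ?thesis
      using T.root_in T.root_no_father True by (intro exI[of _ 1]) (simp add: points_def)
  next
    case False
    then obtain z where z: "(fst u', z) \<in> edges T"
      using T.unique_father T.points_fst[OF u'(1)] by blast
    let ?k = "(height T z - pheight u') / 2"
    have lt: "pheight u' < height T z" by (rule T.points_father[OF u'(1) z])
    have "pheight u' + ?k < height T x'" if "(fst u', x') \<in> edges T" for x'
      using T.father_eq[OF z that] lt by (simp add: field_simps)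
    moreover have "height T (fst u') \<le> pheight u' + ?k" using T.points_height[OF u'(1)] lt by (simp add: field_simps)
    ultimately have "(fst u', pheight u' + ?k) \<in> points T" using T.points_fst[OF u'(1)] by (simp add: points_def)
    then show ?thesis using lt by (intro exI[of _ ?k]) simp
  qed
  then obtain k where k: "k > 0" "(fst u', pheight u' + k) \<in> points T" by blast
  define v where "v = shift T k p'"
  have v: "v \<in> points T" "ple T p' v" "pheight v = pheight p' + k"
    using p' k(1) T.shift_in T.shift_ple T.pheight_shift by (auto simp: v_def)
  have "\<alpha> p \<noteq> \<alpha> v" using \<alpha>_height[OF p] \<alpha>_height[OF v(1)] v(3) h k(1) by force
  then have "pless G (\<alpha> p) (\<alpha> v)" using \<alpha>_mono[OF p' v(1,2)] eq by (simp add: pless_def)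
  then have "ple T u (shift T (2 * \<epsilon>) v)" using shift_less[OF p v(1)] by (simp add: pless_def u_def)
  moreover have "shift T (2 * \<epsilon>) v = (fst u', pheight u' + k)"
  proof (rule T.up_unique[of _ _ p'])
    show "ple T p' (shift T (2 * \<epsilon>) v)"
      using T.shift_ple[OF v(1)] v(2) eps T.ple_trans by simp
    show "ple T p' (fst u', pheight u' + k)"
      using u'(3) k(1) by (simp add: ple_def pheight_def)
    show "pheight (shift T (2 * \<epsilon>) v) = pheight (fst u', pheight u' + k)"
      using T.pheight_shift[OF v(1)] v(3) u'(2) eps by (simp add: pheight_def)
  qed (use T.shift_in[OF v(1)] eps k(2) in auto)
  ultimately have "ple T u u'" using u(2) u'(2) h by (simp add: ple_def)
  then show ?thesis
    using T.up_unique[OF u(1) u'(1) T.ple_refl] u(2) u'(2) h by (simp add: u_def u'_def)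
qed

text \<open>The image is the union of the upward closures of the images of the finitely many
  vertices, so the points of the image above \<open>y\<close> are those above one of finitely many joins, all
  of which lie on the chain above \<open>y\<close>.\<close>

lemma least_image_above:
  assumes y: "y \<in> points G"
  obtains m where "m \<in> \<alpha> ` points T" "ple G y m" "pheight m - pheight y \<le> 2 * \<epsilon>"
    "\<And>q. q \<in> \<alpha> ` points T \<Longrightarrow> ple G y q \<Longrightarrow> ple G m q"
proof -
  have "\<exists>j. j \<in> points G \<and> ple G y j \<and> ple G (\<alpha> (pt T v)) j \<and>
      (\<forall>u\<in>points G. ple G y u \<longrightarrow> ple G (\<alpha> (pt T v)) u \<longrightarrow> ple G j u)" if "v \<in> verts T" for v
    using G.point_join[OF y \<alpha>_in[OF T.pt_in[OF that]]] by metis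
  then obtain j where j: "\<And>v. v \<in> verts T \<Longrightarrow> j v \<in> points G"
    "\<And>v. v \<in> verts T \<Longrightarrow> ple G y (j v)"
    "\<And>v. v \<in> verts T \<Longrightarrow> ple G (\<alpha> (pt T v)) (j v)"
    "\<And>v u. v \<in> verts T \<Longrightarrow> u \<in> points G \<Longrightarrow> ple G y u \<Longrightarrow> ple G (\<alpha> (pt T v)) u \<Longrightarrow> ple G (j v) u"
    by metis
  obtain w where w: "w \<in> verts T" "\<And>v. v \<in> verts T \<Longrightarrow> pheight (j w) \<le> pheight (j v)"
    using ex_is_arg_min_if_finite[OF T.finite_verts, of "\<lambda>v. pheight (j v)"] T.root_in
    unfolding is_arg_min_linorder by blast
  have jw: "j w \<in> \<alpha> ` points T" using image_upward_closed[OF T.pt_in j(1,3)] w(1) by blast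
  have least: "ple G (j w) q" if q: "q \<in> \<alpha> ` points T" "ple G y q" for q
  proof -
    obtain p where p: "p \<in> points T" "q = \<alpha> p" using q(1) by blast
    let ?v = "fst p"
    have v: "?v \<in> verts T" using T.points_fst p(1) .
    have "ple G (\<alpha> (pt T ?v)) q" using \<alpha>_mono T.ple_pt_fst p T.pt_in[OF v] by blast
    then have "ple G (j ?v) q" using j(4)[OF v] \<alpha>_in p q(2) by blast
    moreover have "ple G (j w) (j ?v)"
      using G.ple_chain[OF j(1)[OF w(1)] j(1)[OF v] j(2)[OF w(1)] j(2)[OF v] w(2)[OF v]] .
    ultimately show ?thesis using G.ple_trans by blast
  qed
  have "pheight (j w) - pheight y \<le> 2 * \<epsilon>"
  proof (cases "y \<in> \<alpha> ` points T")
    case True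
    then have "pheight (j w) \<le> pheight y" using least G.ple_refl G.ple_pheight by blast
    then show ?thesis using eps by simp
  next
    case False
    let ?A = "{y' \<in> \<alpha> ` points T. pless G y y'}"
    have A: "q \<in> ?A \<longleftrightarrow> q \<in> \<alpha> ` points T \<and> ple G y q" for q
      using False by (auto simp: pless_def)
    have "pheight (least_in (ple G) ?A) - pheight y \<le> 2 * \<epsilon>"
      using good y False unfolding good_map_def by blast
    moreover have "least_in (ple G) ?A = j w"
      unfolding least_in_def
    proof (rule the_equality)
      show jA: "j w \<in> ?A \<and> (\<forall>a\<in>?A. ple G (j w) a)"
        using A jw j(2)[OF w(1)] least by blast
      show "m = j w" if "m \<in> ?A \<and> (\<forall>a\<in>?A. ple G m a)" for m
        using that jA G.ple_antisym[of m "j w"] \<alpha>_in by blast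
    qed
    ultimately show ?thesis by simp
  qed
  then show ?thesis using that jw j(2)[OF w(1)] least by blast
qed

text \<open>The partner \<open>\<beta>\<close> climbs from \<open>y\<close> to the least image point \<open>m y\<close> above it, takes a preimage
  \<open>z (m y)\<close> of that, and follows the ascending path of the preimage up to the required height, which
  the third property of good maps makes high enough. The preimage depends on \<open>m y\<close> only: this makes
  \<open>\<beta>\<close> monotone.\<close>

lemma ex_interleaving: "\<exists>\<beta>. interleaving T G \<epsilon> \<alpha> \<beta>"
proof -
  have "\<exists>m. m \<in> \<alpha> ` points T \<and> ple G y m \<and> pheight m - pheight y \<le> 2 * \<epsilon> \<and>
      (\<forall>q\<in>\<alpha> ` points T. ple G y q \<longrightarrow> ple G m q)" if "y \<in> points G" for y
    using least_image_above[OF that] by metis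
  then obtain m where m: "\<And>y. y \<in> points G \<Longrightarrow> m y \<in> \<alpha> ` points T"
    "\<And>y. y \<in> points G \<Longrightarrow> ple G y (m y)"
    "\<And>y. y \<in> points G \<Longrightarrow> pheight (m y) - pheight y \<le> 2 * \<epsilon>"
    "\<And>y q. y \<in> points G \<Longrightarrow> q \<in> \<alpha> ` points T \<Longrightarrow> ple G y q \<Longrightarrow> ple G (m y) q"
    by metis
  define z where "z = inv_into (points T) \<alpha>"
  have z: "z q \<in> points T" "\<alpha> (z q) = q" if "q \<in> \<alpha> ` points T" for q
    using inv_into_into[OF that] f_inv_into_f[OF that] by (simp_all add: z_def)
  define \<beta> where "\<beta> y = point_above T (z (m y)) (pheight y + \<epsilon>)" for y
  have m_in: "m y \<in> points G" if "y \<in> points G" for y using m(1)[OF that] \<alpha>_in by auto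
  have zm: "z (m y) \<in> points T" "\<alpha> (z (m y)) = m y" "pheight (z (m y)) = pheight (m y) - \<epsilon>"
    "pheight (z (m y)) \<le> pheight y + \<epsilon>" if "y \<in> points G" for y
    using z[OF m(1)[OF that]] m(3)[OF that] \<alpha>_height[of "z (m y)"] by auto
  have \<beta>: "\<beta> y \<in> points T" "ple T (z (m y)) (\<beta> y)" "pheight (\<beta> y) = pheight y + \<epsilon>"
    if "y \<in> points G" for y
    using T.above_in[OF zm(1,4)] T.above_ple[OF zm(1,4)] T.pheight_above[OF zm(1,4)] that
    by (auto simp: \<beta>_def)
  have m_id: "m y = y" if "y \<in> \<alpha> ` points T" for y
  proof -
    have "y \<in> points G" using that \<alpha>_in by blast
    then show ?thesis
      using m(2) m(4)[OF _ that G.ple_refl] G.ple_antisym m_in by blast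
  qed
  show ?thesis
  proof (intro exI[of _ \<beta>] interleaving.intro interleaving_axioms.intro T.merge_tree_axioms G.merge_tree_axioms)
    show "ple T (\<beta> q) (\<beta> q')" if q: "q \<in> points G" "q' \<in> points G" "ple G q q'" for q q'
    proof -
      have mm: "ple G (m q) (m q')" using m(4)[OF q(1) m(1)[OF q(2)]] G.ple_trans[OF q(3) m(2)[OF q(2)]] .
      show ?thesis
      proof (cases "m q = m q'")
        case True
        then show ?thesis
          using \<beta>(2)[OF q(1)] \<beta>(2)[OF q(2)] \<beta>(3)[OF q(1)] \<beta>(3)[OF q(2)] G.ple_pheight[OF q(3)]
          by (intro T.ple_chain[OF \<beta>(1)[OF q(1)] \<beta>(1)[OF q(2)], of "z (m q)"]) auto
      next
        case False
        have "\<not> ple G q' (m q)"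
          using m(4)[OF q(2) m(1)[OF q(1)]] mm False G.ple_antisym[OF mm] m_in[OF q(1)] by blast
        then have "ple G (m q) q'"
          using G.ple_linear[OF m_in[OF q(1)] q(2) m(2)[OF q(1)] q(3)] by blast
        then have "q' \<in> \<alpha> ` points T"
          using image_upward_closed[OF zm(1)[OF q(1)] q(2)] zm(2)[OF q(1)] by simp
        then have mq': "m q' = q'" by (rule m_id)
        have "pless G (\<alpha> (z (m q))) (\<alpha> (z (m q')))"
          using mm False zm(2) q by (simp add: pless_def)
        then have "ple T (shift T (2 * \<epsilon>) (z (m q))) (shift T (2 * \<epsilon>) (z (m q')))"
          using shift_less zm(1) q by (simp add: pless_def)
        moreover have "shift T (2 * \<epsilon>) (z (m q')) = \<beta> q'"
          using zm(3)[OF q(2)] by (simp add: \<beta>_def shift_def mq' add.commute)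
        moreover have "ple T (\<beta> q) (shift T (2 * \<epsilon>) (z (m q)))"
          unfolding \<beta>_def
          using zm[OF q(1)] eps T.shift_in T.shift_ple T.pheight_shift G.ple_pheight[OF m(2)[OF q(1)]]
          by (intro T.ple_point_above) auto
        ultimately show ?thesis using T.ple_trans by metis
      qed
    qed
    show "ple T p (\<beta> (\<alpha> p))" if p: "p \<in> points T" for p
    proof -
      have \<alpha>p: "\<alpha> p \<in> points G" "m (\<alpha> p) = \<alpha> p" using \<alpha>_in m_id p by auto
      then have "shift T (2 * \<epsilon>) (z (\<alpha> p)) = shift T (2 * \<epsilon>) p"
        using shift_eq[OF _ p] zm(1,2)[OF \<alpha>p(1)] by simp
      moreover have "\<beta> (\<alpha> p) = shift T (2 * \<epsilon>) (z (\<alpha> p))"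
        using zm(3)[OF \<alpha>p(1)] \<alpha>p(2) by (simp add: \<beta>_def shift_def add.commute)
      ultimately show ?thesis using T.shift_ple[OF p] eps by simp
    qed
    show "ple G q (\<alpha> (\<beta> q))" if q: "q \<in> points G" for q
      using \<alpha>_mono[OF zm(1) \<beta>(1,2)] zm(2) m(2) G.ple_trans q by metis
  qed (use eps \<alpha>_in \<alpha>_height \<alpha>_mono \<beta> in auto)
qed

end

section \<open>Persistent vertices\<close>

text \<open>The branch of a vertex that is not persistent merges, within height \<open>\<delta>\<close>, with the branch of
  a lower vertex. For \<open>\<delta> = 2 * \<epsilon>\<close> these vertices are the candidates for deletion.\<close>

definition persistent :: "'v mtree \<Rightarrow> real \<Rightarrow> 'v set" where
  "persistent T \<delta> = {l \<in> verts T. \<forall>u\<in>verts T. ple T (pt T u) (shift T \<delta> (pt T l)) \<longrightarrow> height T l \<le> height T u}"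

context merge_tree
begin

lemma persistent_verts: "l \<in> persistent T \<delta> \<Longrightarrow> l \<in> verts T"
  by (simp add: persistent_def)

lemma height_eqD: "x \<in> verts T \<Longrightarrow> y \<in> verts T \<Longrightarrow> height T x = height T y \<Longrightarrow> x = y"
  using height_inj by (simp add: inj_on_def)

lemma persistent_le:
  assumes l: "l \<in> persistent T \<delta>" and p: "p \<in> points T" "ple T p (shift T \<delta> (pt T l))"
  shows "height T l \<le> height T (fst p)"
proof -
  have "ple T (pt T (fst p)) (shift T \<delta> (pt T l))"
    using ple_trans[OF ple_pt_fst] p by blast
  then show ?thesis using l points_fst[OF p(1)] by (simp add: persistent_def)
qed

lemma persistent_leaf:
  assumes l: "l \<in> persistent T \<delta>" and "0 \<le> \<delta>"
  shows "leaf T l"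
  unfolding leaf_def
proof (intro conjI ballI impI)
  show lv: "l \<in> verts T" by (rule persistent_verts[OF l])
  fix u assume u: "u \<in> verts T" "vle T u l"
  have "ple T (pt T u) (shift T \<delta> (pt T l))"
    using ple_trans[OF _ shift_ple[OF pt_in[OF lv] assms(2)]] ple_pt[OF u(1) pt_in[OF lv]] u(2) by simp
  then have "height T l \<le> height T u" using persistent_le[OF l pt_in[OF u(1)]] by simp
  then show "u = l" using vle_height[OF u(2,1)] height_eqD[OF u(1) lv] by simp
qed

lemma persistent_in_shift:
  assumes x: "x \<in> verts T" and "0 \<le> \<delta>"
  obtains l where "l \<in> persistent T \<delta>" "ple T (pt T l) (shift T \<delta> (pt T x))" "height T l \<le> height T x"
proof -
  let ?s = "shift T \<delta> (pt T x)"
  let ?A = "{v \<in> verts T. ple T (pt T v) ?s}"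
  have s: "?s \<in> points T" "ple T (pt T x) ?s" "pheight ?s = height T x + \<delta>"
    using shift_in shift_ple pheight_shift pt_in[OF x] assms(2) by auto
  have "finite ?A" "x \<in> ?A" using finite_verts x s(2) by auto
  then obtain l where l: "l \<in> ?A" "\<And>v. v \<in> ?A \<Longrightarrow> height T l \<le> height T v"
    using ex_is_arg_min_if_finite[of ?A "height T"] unfolding is_arg_min_linorder by blast
  have lx: "height T l \<le> height T x" using l(2)[OF \<open>x \<in> ?A\<close>] .
  let ?t = "shift T \<delta> (pt T l)"
  have t: "?t \<in> points T" "ple T (pt T l) ?t" "pheight ?t = height T l + \<delta>"
    using shift_in shift_ple pheight_shift pt_in l(1) assms(2) by auto
  have "ple T ?t ?s" using ple_chain[OF t(1) s(1) t(2)] l(1) t(3) s(3) lx by simp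
  then have "l \<in> persistent T \<delta>"
    using l ple_trans by (auto simp: persistent_def)
  then show ?thesis using that l(1) lx by blast
qed

end

section \<open>Adapting an interleaving to the persistent vertices\<close>

context interleaving
begin

lemma \<beta>\<alpha>_eq: assumes "p \<in> points T" shows "\<beta> (\<alpha> p) = shift T (2 * \<epsilon>) p"
proof -
  have "pheight (\<beta> (\<alpha> p)) = pheight p + 2 * \<epsilon>"
    using \<beta>_height[OF \<alpha>_in[OF assms]] \<alpha>_height[OF assms] by simp
  then show ?thesis
    unfolding shift_def using T.above_eq[OF assms \<beta>_in[OF \<alpha>_in] \<beta>\<alpha>_ge] assms by simp
qed

text \<open>Applying \<open>\<beta>\<close> shows that such a point \<open>p\<close> lies below the shift of \<open>l\<close>, where nothing is lower
  than \<open>l\<close>; but \<open>p\<close> is not higher than \<open>l\<close> either.\<close>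

lemma image_below_persistent:
  assumes l: "l \<in> persistent T (2 * \<epsilon>)" and p: "p \<in> points T" and le: "ple G (\<alpha> p) (\<alpha> (pt T l))"
  shows "p = pt T l"
proof -
  note lp = T.pt_in[OF T.persistent_verts[OF l]]
  have "ple T p (shift T (2 * \<epsilon>) (pt T l))"
    using \<beta>_mono[OF \<alpha>_in[OF p] \<alpha>_in[OF lp] le] \<beta>\<alpha>_eq[OF lp] \<beta>\<alpha>_ge[OF p] T.ple_trans by simp
  then have "height T l \<le> height T (fst p)" using T.persistent_le[OF l p] by simp
  moreover have "pheight p \<le> height T l"
    using G.ple_pheight[OF le] \<alpha>_height[OF p] \<alpha>_height[OF lp] by simp
  ultimately have "fst p = l" "pheight p = height T l"
    using T.points_height[OF p] T.height_eqD[OF T.points_fst[OF p] T.persistent_verts[OF l]] by auto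
  then show ?thesis by (intro T.points_eqI) auto
qed

text \<open>The part of \<open>G\<close> below \<open>\<alpha> l\<close>, for a persistent \<open>l\<close>, is mapped below the shift of \<open>l\<close>, and it does
  not matter where. Sending it to the path ascending from \<open>l\<close> makes \<open>l\<close> a candidate for a match with
  any leaf in this part.\<close>

lemma ex_adapted:
  "\<exists>\<beta>'. interleaving T G \<epsilon> \<alpha> \<beta>' \<and>
     (\<forall>l\<in>persistent T (2 * \<epsilon>). \<forall>q\<in>points G. ple G q (\<alpha> (pt T l)) \<longrightarrow> ple T (pt T l) (\<beta>' q)) \<and>
     (\<forall>q. \<beta>' q \<noteq> \<beta> q \<longrightarrow> (\<exists>l\<in>persistent T (2 * \<epsilon>). ple G q (\<alpha> (pt T l))))"
proof -
  define P where "P q l \<longleftrightarrow> l \<in> persistent T (2 * \<epsilon>) \<and> ple G q (\<alpha> (pt T l))" for q l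
  define \<beta>' where "\<beta>' q = (if \<exists>l. P q l then point_above T (pt T (SOME l. P q l)) (pheight q + \<epsilon>) else \<beta> q)" for q
  have pt_l: "pt T l \<in> points T" if "P q l" for q l
    using that T.pt_in T.persistent_verts by (auto simp: P_def)
  have unique: "l = l'" if l: "P q l" and l': "P q l'" for q l l'
  proof -
    have "pt T l = pt T l'"
      using G.ple_linear[OF \<alpha>_in[OF pt_l[OF l]] \<alpha>_in[OF pt_l[OF l']], of q]
        image_below_persistent[OF _ pt_l[OF l], of l'] image_below_persistent[OF _ pt_l[OF l'], of l] l l'
      by (auto simp: P_def)
    then show ?thesis by (simp add: pt_def)
  qed
  have \<beta>'_P: "\<beta>' q = point_above T (pt T l) (pheight q + \<epsilon>)" if "P q l" for q l
  proof -
    have "(SOME l. P q l) = l" using unique someI[of "P q", OF that] that by blast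
    then show ?thesis using that by (auto simp: \<beta>'_def)
  qed
  have below: "ple T (\<beta> q) (shift T (2 * \<epsilon>) (pt T l))" "height T l \<le> pheight q + \<epsilon>"
    if q: "q \<in> points G" and l: "P q l" for q l
  proof -
    show le: "ple T (\<beta> q) (shift T (2 * \<epsilon>) (pt T l))"
      using \<beta>_mono[OF q \<alpha>_in[OF pt_l[OF l]]] \<beta>\<alpha>_eq[OF pt_l[OF l]] l by (simp add: P_def)
    have "height T l \<le> height T (fst (\<beta> q))" using T.persistent_le[OF _ \<beta>_in[OF q] le] l by (simp add: P_def)
    then show "height T l \<le> pheight q + \<epsilon>"
      using T.points_height[OF \<beta>_in[OF q]] \<beta>_height[OF q] by simp
  qed
  have above: "\<beta>' q \<in> points T" "ple T (pt T l) (\<beta>' q)" "pheight (\<beta>' q) = pheight q + \<epsilon>"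
    if q: "q \<in> points G" and l: "P q l" for q l
    unfolding \<beta>'_P[OF l]
    using below(2)[OF q l] T.above_in[OF pt_l[OF l]] T.above_ple[OF pt_l[OF l]] T.pheight_above[OF pt_l[OF l]]
    by auto
  have \<beta>'_nP: "\<beta>' q = \<beta> q" if "\<nexists>l. P q l" for q using that by (simp add: \<beta>'_def)
  have \<beta>': "\<beta>' q \<in> points T" "pheight (\<beta>' q) = pheight q + \<epsilon>" if q: "q \<in> points G" for q
    using above[OF q] \<beta>'_nP \<beta>_in[OF q] \<beta>_height[OF q] by (metis, metis)
  have "interleaving T G \<epsilon> \<alpha> \<beta>'"
  proof (intro interleaving.intro interleaving_axioms.intro T.merge_tree_axioms G.merge_tree_axioms)
    show "ple T (\<beta>' q) (\<beta>' q')" if q: "q \<in> points G" "q' \<in> points G" "ple G q q'" for q q'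
    proof (cases "\<exists>l. P q' l")
      case True
      then obtain l where l': "P q' l" by blast
      have l: "P q l" using l' q(3) G.ple_trans by (auto simp: P_def)
      show ?thesis
        using T.ple_chain[OF above(1)[OF q(1) l] above(1)[OF q(2) l'] above(2)[OF q(1) l] above(2)[OF q(2) l']]
          above(3)[OF q(1) l] above(3)[OF q(2) l'] G.ple_pheight[OF q(3)] by simp
    next
      case False
      note q'_eq = \<beta>'_nP[OF this]
      show ?thesis
      proof (cases "\<exists>l. P q l")
        case True
        then obtain l where l: "P q l" by blast
        have "ple G (\<alpha> (pt T l)) q'"
          using G.ple_linear[OF \<alpha>_in[OF pt_l[OF l]] q(2), of q] l q(3) False by (auto simp: P_def)
        then have "ple T (shift T (2 * \<epsilon>) (pt T l)) (\<beta> q')"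
          using \<beta>_mono[OF \<alpha>_in[OF pt_l[OF l]] q(2)] \<beta>\<alpha>_eq[OF pt_l[OF l]] by simp
        moreover have "ple T (\<beta>' q) (shift T (2 * \<epsilon>) (pt T l))"
        proof (rule T.ple_chain[OF above(1)[OF q(1) l] _ above(2)[OF q(1) l]])
          show "pheight (\<beta>' q) \<le> pheight (shift T (2 * \<epsilon>) (pt T l))"
            using T.ple_pheight[OF below(1)[OF q(1) l]] \<beta>_height[OF q(1)] above(3)[OF q(1) l] by simp
        qed (use T.shift_in T.shift_ple pt_l[OF l] eps in auto)
        ultimately show ?thesis using T.ple_trans q'_eq by simp
      next
        case False
        then show ?thesis using \<beta>'_nP q'_eq \<beta>_mono[OF q] by simp
      qed
    qed
    show "ple T p (\<beta>' (\<alpha> p))" if p: "p \<in> points T" for p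
    proof (cases "\<exists>l. P (\<alpha> p) l")
      case True
      then obtain l where l: "P (\<alpha> p) l" by blast
      then have "p = pt T l" using image_below_persistent[OF _ p] by (simp add: P_def)
      then show ?thesis using above(2)[OF \<alpha>_in[OF p] l] by simp
    next
      case False
      then show ?thesis using \<beta>'_nP \<beta>\<alpha>_ge[OF p] by simp
    qed
    show "ple G q (\<alpha> (\<beta>' q))" if q: "q \<in> points G" for q
    proof (cases "\<exists>l. P q l")
      case True
      then obtain l where l: "P q l" by blast
      then have "ple G q (\<alpha> (pt T l))" by (simp add: P_def)
      then show ?thesis
        using \<alpha>_mono[OF pt_l[OF l] above(1)[OF q l] above(2)[OF q l]] G.ple_trans by blast
    next
      case False
      then show ?thesis using \<beta>'_nP \<alpha>\<beta>_ge[OF q] by simp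
    qed
  qed (use eps \<alpha>_in \<alpha>_height \<alpha>_mono \<beta>' in auto)
  moreover have "ple T (pt T l) (\<beta>' q)"
    if "l \<in> persistent T (2 * \<epsilon>)" "q \<in> points G" "ple G q (\<alpha> (pt T l))" for l q
    using above(2)[OF that(2), of l] that by (simp add: P_def)
  moreover have "\<exists>l\<in>persistent T (2 * \<epsilon>). ple G q (\<alpha> (pt T l))" if "\<beta>' q \<noteq> \<beta> q" for q
    using \<beta>'_nP[of q] that by (auto simp: P_def)
  ultimately show ?thesis by blast
qed

text \<open>Compatibility makes upper bounds correspond: \<open>\<alpha>\<close> sends every point above \<open>x\<close> to a point
  above \<open>y\<close>, and \<open>\<beta>\<close> every point above \<open>y\<close> to a point above \<open>x\<close>.\<close>

definition compatible :: "'v \<Rightarrow> 'w \<Rightarrow> bool" where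
  "compatible x y \<longleftrightarrow> leaf T x \<and> leaf G y \<and> ple G (pt G y) (\<alpha> (pt T x)) \<and> ple T (pt T x) (\<beta> (pt G y))"

lemma compatible_inj:
  assumes "compatible l y" "compatible l' y" "l \<in> persistent T (2 * \<epsilon>)" "l' \<in> persistent T (2 * \<epsilon>)"
  shows "l = l'"
proof -
  note p = T.pt_in[OF T.persistent_verts[OF assms(3)]]
  note p' = T.pt_in[OF T.persistent_verts[OF assms(4)]]
  have "pt T l = pt T l'"
    using G.ple_linear[OF \<alpha>_in[OF p] \<alpha>_in[OF p'], of "pt G y"] assms
      image_below_persistent[OF assms(4) p] image_below_persistent[OF assms(3) p']
    by (auto simp: compatible_def)
  then show ?thesis by (simp add: pt_def)
qed

lemma compatible_swap: "interleaving.compatible G T \<beta> \<alpha> y x \<longleftrightarrow> compatible x y"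
  using interleaving.compatible_def[OF interleaving_swap[OF interleaving_axioms]]
  by (auto simp: compatible_def)

end

text \<open>The interleaving is adapted to \<open>T\<close> by changing \<open>\<beta>\<close>, then to \<open>G\<close> by changing \<open>\<alpha>\<close>. The second step
  does not destroy what the first achieved: where it changes the image of a persistent \<open>l\<close>, it
  makes \<open>l\<close> compatible with a persistent vertex of \<open>G\<close>.\<close>

lemma (in interleaving) ex_adapted_to_both:
  obtains \<alpha>' \<beta>' where "interleaving T G \<epsilon> \<alpha>' \<beta>'"
    "\<And>l. l \<in> persistent T (2 * \<epsilon>) \<Longrightarrow> \<exists>y. interleaving.compatible T G \<alpha>' \<beta>' l y"
    "\<And>w. w \<in> persistent G (2 * \<epsilon>) \<Longrightarrow> \<exists>x. interleaving.compatible T G \<alpha>' \<beta>' x w"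
proof -
  obtain \<beta>' where \<beta>': "interleaving T G \<epsilon> \<alpha> \<beta>'"
    "\<And>l q. l \<in> persistent T (2 * \<epsilon>) \<Longrightarrow> q \<in> points G \<Longrightarrow> ple G q (\<alpha> (pt T l)) \<Longrightarrow> ple T (pt T l) (\<beta>' q)"
    using ex_adapted by blast
  obtain \<alpha>' where \<alpha>': "interleaving G T \<epsilon> \<beta>' \<alpha>'"
    "\<And>w p. w \<in> persistent G (2 * \<epsilon>) \<Longrightarrow> p \<in> points T \<Longrightarrow> ple T p (\<beta>' (pt G w)) \<Longrightarrow> ple G (pt G w) (\<alpha>' p)"
    "\<And>p. \<alpha>' p \<noteq> \<alpha> p \<Longrightarrow> \<exists>w\<in>persistent G (2 * \<epsilon>). ple T p (\<beta>' (pt G w))"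
    using interleaving.ex_adapted[OF interleaving_swap[OF \<beta>'(1)]] by blast
  have I: "interleaving T G \<epsilon> \<alpha>' \<beta>'" using interleaving_swap[OF \<alpha>'(1)] .
  interpret I: interleaving T G \<epsilon> \<alpha>' \<beta>' by (rule I)
  have "\<exists>y. I.compatible l y" if l: "l \<in> persistent T (2 * \<epsilon>)" for l
  proof -
    note lp = T.pt_in[OF T.persistent_verts[OF l]]
    have ll: "leaf T l" using T.persistent_leaf[OF l] eps by simp
    show ?thesis
    proof (cases "\<exists>w\<in>persistent G (2 * \<epsilon>). ple T (pt T l) (\<beta>' (pt G w))")
      case True
      then obtain w where w: "w \<in> persistent G (2 * \<epsilon>)" "ple T (pt T l) (\<beta>' (pt G w))" by blast
      have "I.compatible l w"
        using ll G.persistent_leaf[OF w(1)] eps \<alpha>'(2)[OF w(1) lp w(2)] w(2)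
        by (simp add: I.compatible_def)
      then show ?thesis by blast
    next
      case False
      then have eq: "\<alpha>' (pt T l) = \<alpha> (pt T l)" using \<alpha>'(3) by blast
      obtain y where y: "leaf G y" "ple G (pt G y) (\<alpha> (pt T l))" using G.leaf_below[OF \<alpha>_in[OF lp]] .
      have "pt G y \<in> points G" using y(1) G.pt_in by (simp add: leaf_def)
      then have "I.compatible l y" using ll y eq \<beta>'(2)[OF l _ y(2)] by (simp add: I.compatible_def)
      then show ?thesis by blast
    qed
  qed
  moreover have "\<exists>x. I.compatible x w" if w: "w \<in> persistent G (2 * \<epsilon>)" for w
  proof -
    note wp = G.pt_in[OF G.persistent_verts[OF w]]
    obtain x where x: "leaf T x" "ple T (pt T x) (\<beta>' (pt G w))" using T.leaf_below[OF I.\<beta>_in[OF wp]] .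
    have "pt T x \<in> points T" using x(1) T.pt_in by (simp add: leaf_def)
    then have "I.compatible x w"
      using G.persistent_leaf[OF w] eps x \<alpha>'(2)[OF w _ x(2)] by (simp add: I.compatible_def)
    then show ?thesis by blast
  qed
  ultimately show ?thesis using that I by blast
qed

section \<open>The matching of leaves\<close>

text \<open>As in the Schroeder-Bernstein theorem, a fixed point \<open>A\<close> consists of the elements of \<open>X\<close> to be
  matched by \<open>f\<close>: what \<open>f\<close> then leaves over of \<open>Y\<close> is matched by \<open>g\<close>, and \<open>g\<close> reaches all of \<open>X\<close>
  outside of \<open>A\<close>, but nothing in \<open>A\<close>.\<close>

lemma ex_matching_covering_both:
  assumes f: "inj_on f X" and g: "inj_on g Y"
  obtains M where "M \<subseteq> {(x, f x) | x. x \<in> X} \<union> {(g y, y) | y. y \<in> Y}"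
    "inj_on fst M" "inj_on snd M" "X \<subseteq> Domain M" "Y \<subseteq> Range M"
proof -
  define A where "A = lfp (\<lambda>S. X - g ` (Y - f ` S))"
  have "mono (\<lambda>S. X - g ` (Y - f ` S))" by (rule monoI) blast
  then have A: "A = X - g ` (Y - f ` A)" unfolding A_def by (rule lfp_unfold)
  let ?M = "(\<lambda>x. (x, f x)) ` A \<union> (\<lambda>y. (g y, y)) ` (Y - f ` A)"
  have AX: "A \<subseteq> X" and Ag: "\<And>y. y \<in> Y \<Longrightarrow> y \<notin> f ` A \<Longrightarrow> g y \<notin> A"
    and XA: "\<And>x. x \<in> X \<Longrightarrow> x \<in> A \<or> x \<in> g ` (Y - f ` A)"
    using A by blast+
  have "inj_on fst ?M"
    using Ag by (intro inj_onI) (auto dest: inj_onD[OF g])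
  moreover have "inj_on snd ?M"
    by (intro inj_onI) (auto dest: inj_onD[OF inj_on_subset[OF f AX]])
  moreover have "X \<subseteq> Domain ?M" using XA by (auto simp: Domain_fst image_Un image_image)
  moreover have "Y \<subseteq> Range ?M" by (auto simp: Range_snd image_Un image_image)
  moreover have "?M \<subseteq> {(x, f x) | x. x \<in> X} \<union> {(g y, y) | y. y \<in> Y}" using AX by blast
  ultimately show ?thesis using that by blast
qed

text \<open>The last assumption excludes superfluous matches: with a high partner they would raise \<open>eta\<close>,
  and with it the cost of deleting a low vertex nearby.\<close>

locale matched_interleaving = interleaving T G \<epsilon> \<alpha> \<beta>
  for T :: "'v mtree" and G :: "'w mtree" and \<epsilon> \<alpha> \<beta> +
  fixes M :: "('v \<times> 'w) set"
  assumes M_compatible: "(x, y) \<in> M \<Longrightarrow> compatible x y"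
    and M_inj: "inj_on fst M" "inj_on snd M"
    and M_covers: "persistent T (2 * \<epsilon>) \<subseteq> Domain M" "persistent G (2 * \<epsilon>) \<subseteq> Range M"
    and M_persistent: "(x, y) \<in> M \<Longrightarrow> x \<in> persistent T (2 * \<epsilon>) \<or> y \<in> persistent G (2 * \<epsilon>)"

lemma (in interleaving) ex_matched_interleaving:
  "\<exists>\<alpha>' \<beta>' M. matched_interleaving T G \<epsilon> \<alpha>' \<beta>' M"
proof -
  obtain \<alpha>' \<beta>' where I: "interleaving T G \<epsilon> \<alpha>' \<beta>'"
    "\<And>l. l \<in> persistent T (2 * \<epsilon>) \<Longrightarrow> \<exists>y. interleaving.compatible T G \<alpha>' \<beta>' l y"
    "\<And>w. w \<in> persistent G (2 * \<epsilon>) \<Longrightarrow> \<exists>x. interleaving.compatible T G \<alpha>' \<beta>' x w"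
    using ex_adapted_to_both by blast
  interpret I: interleaving T G \<epsilon> \<alpha>' \<beta>' by (rule I)
  interpret J: interleaving G T \<epsilon> \<beta>' \<alpha>' by (rule interleaving_swap[OF I(1)])
  obtain f where f: "\<And>l. l \<in> persistent T (2 * \<epsilon>) \<Longrightarrow> I.compatible l (f l)" using I(2) by metis
  obtain g where g: "\<And>w. w \<in> persistent G (2 * \<epsilon>) \<Longrightarrow> I.compatible (g w) w" using I(3) by metis
  have "inj_on f (persistent T (2 * \<epsilon>))"
    using f I.compatible_inj unfolding inj_on_def by metis
  moreover have "inj_on g (persistent G (2 * \<epsilon>))"
    using g J.compatible_inj unfolding inj_on_def I.compatible_swap by metis
  ultimately obtain M where M: "M \<subseteq> {(x, f x) | x. x \<in> persistent T (2 * \<epsilon>)} \<union> {(g y, y) | y. y \<in> persistent G (2 * \<epsilon>)}"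
    "inj_on fst M" "inj_on snd M" "persistent T (2 * \<epsilon>) \<subseteq> Domain M" "persistent G (2 * \<epsilon>) \<subseteq> Range M"
    using ex_matching_covering_both[of f _ g] by blast
  have "matched_interleaving T G \<epsilon> \<alpha>' \<beta>' M"
    by unfold_locales (use M f g in auto)
  then show ?thesis by blast
qed

lemma matched_interleaving_swap:
  assumes "matched_interleaving T G \<epsilon> \<alpha> \<beta> M"
  shows "matched_interleaving G T \<epsilon> \<beta> \<alpha> (M\<inverse>)"
proof -
  interpret matched_interleaving T G \<epsilon> \<alpha> \<beta> M by (rule assms)
  interpret J: interleaving G T \<epsilon> \<beta> \<alpha> by (rule interleaving_swap[OF interleaving_axioms])
  show ?thesis
  proof unfold_locales
    show "J.compatible y x" if "(y, x) \<in> M\<inverse>" for y x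
      using M_compatible[of x y] compatible_swap[of y x] that by simp
    show "y \<in> persistent G (2 * \<epsilon>) \<or> x \<in> persistent T (2 * \<epsilon>)" if "(y, x) \<in> M\<inverse>" for y x
      using M_persistent[of x y] that by auto
    show "inj_on fst (M\<inverse>)" "inj_on snd (M\<inverse>)" 
      using M_inj by (auto simp: inj_on_def Ball_def)
  qed (use M_covers in auto)
qed

section \<open>The coupling\<close>

text \<open>A set of matches is a common cluster if it consists of all matches below some vertex
  of \<open>T\<close> and also of all matches below some vertex of \<open>G\<close>; the lowest such vertices are the
  least common ancestors, and these two are coupled.\<close>

definition common_clusters :: "'v mtree \<Rightarrow> 'w mtree \<Rightarrow> ('v \<times> 'w) set \<Rightarrow> ('v \<times> 'w) set set" where
  "common_clusters T G M = {S. S \<noteq> {} \<and>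
     S = {(x, y) \<in> M. vle T x (LCA T (Domain S))} \<and> S = {(x, y) \<in> M. vle G y (LCA G (Range S))}}"

definition cluster_coupling :: "'v mtree \<Rightarrow> 'w mtree \<Rightarrow> ('v \<times> 'w) set \<Rightarrow> ('v \<times> 'w) set" where
  "cluster_coupling T G M = (\<lambda>S. (LCA T (Domain S), LCA G (Range S))) ` common_clusters T G M"

lemma converse_eq_restriction:
  "S\<inverse> = {(y, x) \<in> M\<inverse>. P y} \<longleftrightarrow> S = {(x, y) \<in> M. P y}"
  "S\<inverse> = {(y, x) \<in> M\<inverse>. Q x} \<longleftrightarrow> S = {(x, y) \<in> M. Q x}"
  by (auto simp: set_eq_iff)

lemma converse_eq_empty: "S\<inverse> = {} \<longleftrightarrow> S = {}"
  by auto

lemma common_clusters_converse: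
  fixes T :: "'v mtree" and G :: "'w mtree"
  shows "S\<inverse> \<in> common_clusters G T (M\<inverse>) \<longleftrightarrow> S \<in> common_clusters T G M"
  by (simp only: common_clusters_def mem_Collect_eq Domain_converse Range_converse
      converse_eq_restriction converse_eq_empty) blast

lemma cluster_coupling_converse: "cluster_coupling G T (M\<inverse>) = (cluster_coupling T G M)\<inverse>"
proof
  show "cluster_coupling G T (M\<inverse>) \<subseteq> (cluster_coupling T G M)\<inverse>"
  proof
    fix p assume "p \<in> cluster_coupling G T (M\<inverse>)"
    then obtain S where S: "S \<in> common_clusters G T (M\<inverse>)" "p = (LCA G (Domain S), LCA T (Range S))"
      by (auto simp: cluster_coupling_def)
    then have "S\<inverse> \<in> common_clusters T G M" using common_clusters_converse[of "S\<inverse>"] by simp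
    then have "(LCA T (Domain (S\<inverse>)), LCA G (Range (S\<inverse>))) \<in> cluster_coupling T G M"
      unfolding cluster_coupling_def by (rule imageI)
    then show "p \<in> (cluster_coupling T G M)\<inverse>" using S(2) by simp
  qed
  show "(cluster_coupling T G M)\<inverse> \<subseteq> cluster_coupling G T (M\<inverse>)"
  proof
    fix p assume p: "p \<in> (cluster_coupling T G M)\<inverse>"
    then obtain S where S: "S \<in> common_clusters T G M" "p = (LCA G (Range S), LCA T (Domain S))"
      by (auto simp: cluster_coupling_def)
    then have "S\<inverse> \<in> common_clusters G T (M\<inverse>)" using common_clusters_converse by blast
    then have "(LCA G (Domain (S\<inverse>)), LCA T (Range (S\<inverse>))) \<in> cluster_coupling G T (M\<inverse>)"
      unfolding cluster_coupling_def by (rule imageI)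
    then show "p \<in> cluster_coupling G T (M\<inverse>)" using S(2) by simp
  qed
qed

lemma (in merge_tree) ex_maximal_below:
  assumes "A \<subseteq> verts T" "c \<in> A" "vless T c x"
  shows "\<exists>c'\<in>Lam T A x. vle T c c'"
proof -
  let ?B = "{c' \<in> A. vless T c' x \<and> vle T c c'}"
  have "finite ?B" "c \<in> ?B"
    using assms finite_subset[OF _ finite_verts] vle_refl by auto
  then obtain m where m: "m \<in> ?B" "\<And>c'. c' \<in> ?B \<Longrightarrow> - height T m \<le> - height T c'"
    using ex_is_arg_min_if_finite[of ?B "\<lambda>v. - height T v"] unfolding is_arg_min_linorder by blast
  have "False" if a: "a \<in> A" "vless T a x" "vless T m a" for a
  proof -
    have "vle T c a" using m(1) a(3) vle_trans by (auto simp: vless_def)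
    then have "height T a \<le> height T m" using m(2)[of a] a by simp
    moreover have "height T m < height T a" using height_mono a assms(1) m(1) by auto
    ultimately show False by simp
  qed
  then have "m \<in> Lam T A x" using m(1) by (auto simp: Lam_def)
  then show ?thesis using m(1) by blast
qed

context matched_interleaving
begin

abbreviation C where "C \<equiv> cluster_coupling T G M"

lemma swap: "matched_interleaving G T \<epsilon> \<beta> \<alpha> (M\<inverse>)"
  by (rule matched_interleaving_swap[OF matched_interleaving_axioms])

lemma M_leaf: "(x, y) \<in> M \<Longrightarrow> leaf T x" "(x, y) \<in> M \<Longrightarrow> leaf G y"
  using M_compatible by (auto simp: compatible_def)

lemma M_verts: "(x, y) \<in> M \<Longrightarrow> x \<in> verts T" "(x, y) \<in> M \<Longrightarrow> y \<in> verts G"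
  using M_leaf by (auto simp: leaf_def)

lemma M_images:
  "(x, y) \<in> M \<Longrightarrow> ple G (pt G y) (\<alpha> (pt T x))" "(x, y) \<in> M \<Longrightarrow> ple T (pt T x) (\<beta> (pt G y))"
  using M_compatible by (auto simp: compatible_def)

lemma M_heights:
  assumes "(x, y) \<in> M"
  shows "height G y \<le> height T x + \<epsilon>" "height T x \<le> height G y + \<epsilon>"
  using G.ple_pheight[OF M_images(1)[OF assms]] T.ple_pheight[OF M_images(2)[OF assms]]
    \<alpha>_height[OF T.pt_in[OF M_verts(1)[OF assms]]] \<beta>_height[OF G.pt_in[OF M_verts(2)[OF assms]]] by auto

lemma M_nonempty: "M \<noteq> {}"
proof -
  obtain l where "l \<in> persistent T (2 * \<epsilon>)"
    using T.persistent_in_shift[OF T.root_in, of "2 * \<epsilon>"] eps by auto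
  then show ?thesis using M_covers(1) by blast
qed

lemma cluster_Domain: "S \<subseteq> M \<Longrightarrow> S \<noteq> {} \<Longrightarrow> Domain S \<subseteq> verts T \<and> Domain S \<noteq> {}"
  using M_verts by auto

lemma M_below:
  assumes m: "(x, y) \<in> M" and p: "p \<in> points T" and le: "vle T x (fst p)"
  shows "vle G y (fst (\<alpha> p))"
proof -
  have "ple G (\<alpha> (pt T x)) (\<alpha> p)"
    using \<alpha>_mono[OF T.pt_in[OF M_verts(1)[OF m]] p] T.ple_pt[OF M_verts(1)[OF m] p] le by simp
  then have "ple G (pt G y) (\<alpha> p)" using M_images(1)[OF m] G.ple_trans by blast
  then show ?thesis using G.ple_pt[OF M_verts(2)[OF m] \<alpha>_in[OF p]] by simp
qed

text \<open>An upper bound \<open>v\<close> of some matched leaves of \<open>T\<close> is sent by \<open>\<alpha>\<close> to an upper bound of their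
  partners, at height \<open>\<epsilon>\<close> more.\<close>

lemma LCA_Range_height:
  assumes S: "S \<subseteq> M" "S \<noteq> {}" and v: "v \<in> verts T" "\<And>x. x \<in> Domain S \<Longrightarrow> vle T x v"
  shows "height G (LCA G (Range S)) \<le> height T v + \<epsilon>"
proof -
  have RS: "Range S \<subseteq> verts G" "Range S \<noteq> {}" using S M_verts by auto
  note p = T.pt_in[OF v(1)]
  have "vle G y (fst (\<alpha> (pt T v)))" if y: "y \<in> Range S" for y
  proof -
    obtain x where x: "(x, y) \<in> S" using y by blast
    then show ?thesis using M_below[OF _ p, of x y] v(2)[OF DomainI[OF x]] S(1) by auto
  qed
  then have "vle G (LCA G (Range S)) (fst (\<alpha> (pt T v)))"
    by (rule G.LCA_least[OF RS G.points_fst[OF \<alpha>_in[OF p]]])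
  then have "height G (LCA G (Range S)) \<le> height G (fst (\<alpha> (pt T v)))"
    using G.vle_height G.LCA_in[OF RS] by blast
  also have "\<dots> \<le> pheight (\<alpha> (pt T v))" by (rule G.points_height[OF \<alpha>_in[OF p]])
  finally show ?thesis using \<alpha>_height[OF p] by simp
qed

lemma cluster_subset: "S \<in> common_clusters T G M \<Longrightarrow> S \<subseteq> M" "S \<in> common_clusters T G M \<Longrightarrow> S \<noteq> {}"
  by (auto simp: common_clusters_def)

lemma cluster_memI:
  "S \<in> common_clusters T G M \<Longrightarrow> (x, y) \<in> M \<Longrightarrow> vle T x (LCA T (Domain S)) \<Longrightarrow> (x, y) \<in> S"
  by (auto simp: common_clusters_def)

lemma cluster_LCA_in: "S \<in> common_clusters T G M \<Longrightarrow> LCA T (Domain S) \<in> verts T"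
  using T.LCA_in[of "Domain S"] cluster_Domain[of S] cluster_subset[of S] by simp

lemma cluster_upper: "S \<in> common_clusters T G M \<Longrightarrow> (x, y) \<in> S \<Longrightarrow> vle T x (LCA T (Domain S))"
  using T.LCA_upper[of "Domain S" x] cluster_Domain[of S] cluster_subset[of S] DomainI[of x y S] by simp

text \<open>The order on coupled vertices is the inclusion of clusters. Since this holds in both trees, the
  coupling preserves and reflects the order.\<close>

lemma cluster_le_iff:
  assumes S: "S \<in> common_clusters T G M" and S': "S' \<in> common_clusters T G M"
  shows "vle T (LCA T (Domain S)) (LCA T (Domain S')) \<longleftrightarrow> S \<subseteq> S'"
proof
  assume le: "vle T (LCA T (Domain S)) (LCA T (Domain S'))"
  show "S \<subseteq> S'"
    using cluster_memI[OF S'] T.vle_trans[OF cluster_upper[OF S] le] cluster_subset(1)[OF S] by auto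
next
  assume "S \<subseteq> S'"
  then show "vle T (LCA T (Domain S)) (LCA T (Domain S'))"
    using T.LCA_least[of "Domain S" "LCA T (Domain S')"] cluster_Domain[OF cluster_subset[OF S]]
      cluster_LCA_in[OF S'] cluster_upper[OF S'] by auto
qed

lemma cluster_LCA_inj:
  assumes "S \<in> common_clusters T G M" "S' \<in> common_clusters T G M" "LCA T (Domain S) = LCA T (Domain S')"
  shows "S = S'"
  using cluster_le_iff[OF assms(1,2)] cluster_le_iff[OF assms(2,1)] assms(3) T.vle_refl by auto

lemma cluster_less_iff:
  assumes "S \<in> common_clusters T G M" "S' \<in> common_clusters T G M"
  shows "vless T (LCA T (Domain S)) (LCA T (Domain S')) \<longleftrightarrow> S \<subset> S'"
  using cluster_le_iff[OF assms] cluster_LCA_inj[OF assms] by (auto simp: vless_def)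

lemma C_E:
  assumes "(a, b) \<in> C"
  obtains S where "S \<in> common_clusters T G M" "a = LCA T (Domain S)" "b = LCA G (Range S)"
  using assms by (auto simp: cluster_coupling_def)

lemma Domain_C: "Domain C = (\<lambda>S. LCA T (Domain S)) ` common_clusters T G M"
  by (auto simp: cluster_coupling_def Domain_fst image_image)

lemma Domain_C_verts: "Domain C \<subseteq> verts T"
  using cluster_LCA_in by (auto simp: Domain_C)

lemma LCA_singleton: "x \<in> verts T \<Longrightarrow> LCA T {x} = x"
  using T.LCA_in[of "{x}"] T.LCA_upper[of "{x}" x] T.LCA_least[of "{x}" x] T.vle_antisym[of x "LCA T {x}"] T.vle_refl
  by auto

lemma M_singleton:
  assumes m: "(x, y) \<in> M"
  shows "{(x, y)} = {(x', y') \<in> M. vle T x' (LCA T (Domain {(x, y)}))}"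
proof -
  have eq: "(x', y') = (x, y)" if m': "(x', y') \<in> M" and le: "vle T x' x" for x' y'
  proof -
    have "x' = x" using M_leaf(1)[OF m] M_verts(1)[OF m'] le by (simp add: leaf_def)
    then show ?thesis using inj_onD[OF M_inj(1) _ m' m] by simp
  qed
  have LCA: "LCA T (Domain {(x, y)}) = x" using LCA_singleton[OF M_verts(1)[OF m]] by simp
  show ?thesis
    unfolding LCA
  proof
    show "{(x, y)} \<subseteq> {(x', y') \<in> M. vle T x' x}" using m T.vle_refl by simp
    show "{(x', y') \<in> M. vle T x' x} \<subseteq> {(x, y)}"
    proof
      fix p assume "p \<in> {(x', y') \<in> M. vle T x' x}"
      then show "p \<in> {(x, y)}" using eq[of "fst p" "snd p"] by auto
    qed
  qed
qed

lemma M_total: "M = {(x, y) \<in> M. vle T x (LCA T (Domain M))}"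
  using T.LCA_upper[of "Domain M"] cluster_Domain[of M] M_nonempty by auto

lemma singleton_cluster:
  assumes m: "(x, y) \<in> M"
  shows "{(x, y)} \<in> common_clusters T G M"
proof -
  have "{(x, y)}\<inverse> = {(y', x') \<in> M\<inverse>. vle G y' (LCA G (Range {(x, y)}))}"
  proof -
    have conv: "{(x, y)}\<inverse> = {(y, x)}" "Range {(x, y)} = Domain {(y, x)}" by auto
    show ?thesis unfolding conv by (rule matched_interleaving.M_singleton[OF swap converseI[OF m]])
  qed
  then have "{(x, y)} = {(x', y') \<in> M. vle G y' (LCA G (Range {(x, y)}))}"
    by (simp only: converse_eq_restriction)
  then show ?thesis
    unfolding common_clusters_def mem_Collect_eq
    by (intro conjI insert_not_empty M_singleton[OF m])
qed

lemma M_cluster: "M \<in> common_clusters T G M"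
proof -
  have "M = {(x, y) \<in> M. vle G y (LCA G (Range M))}"
    using matched_interleaving.M_total[OF swap] by (simp only: Domain_converse converse_eq_restriction)
  then show ?thesis
    unfolding common_clusters_def mem_Collect_eq by (intro conjI M_nonempty M_total)
qed

lemma M_subset_C: "M \<subseteq> C"
proof
  fix m assume m: "m \<in> M"
  obtain x y where xy: "m = (x, y)" by fastforce
  have "(LCA T (Domain {(x, y)}), LCA G (Range {(x, y)})) \<in> C"
    unfolding cluster_coupling_def using singleton_cluster m xy by blast
  then show "m \<in> C"
    using LCA_singleton M_verts m xy matched_interleaving.LCA_singleton[OF swap] by simp
qed

text \<open>If only one coupled vertex were directly below \<open>c\<close>, then every leaf matched below \<open>c\<close> would be
  below that vertex as well, and the two would have the same cluster.\<close>

lemma card_Lam_C: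
  assumes c: "c \<in> Domain C"
  shows "card (Lam T (Domain C) c) \<noteq> 1"
proof
  assume "card (Lam T (Domain C) c) = 1"
  then obtain d where d: "Lam T (Domain C) c = {d}" by (rule card_1_singletonE)
  then have dc: "d \<in> Domain C" "vless T d c" by (auto simp: Lam_def)
  obtain S where S: "S \<in> common_clusters T G M" "c = LCA T (Domain S)" using c by (auto simp: Domain_C)
  obtain S' where S': "S' \<in> common_clusters T G M" "d = LCA T (Domain S')" using dc(1) by (auto simp: Domain_C)
  have "S' \<subset> S" using cluster_less_iff[OF S'(1) S(1)] dc(2) S S' by simp
  then obtain x y where xy: "(x, y) \<in> S" "(x, y) \<notin> S'" by auto
  then have m: "(x, y) \<in> M" using cluster_subset(1)[OF S(1)] by blast
  have "{(x, y)} \<subset> S" using \<open>S' \<subset> S\<close> cluster_subset(2)[OF S'(1)] xy by blast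
  then have "vless T x c"
    using cluster_less_iff[OF singleton_cluster[OF m] S(1)] LCA_singleton M_verts(1)[OF m] S(2) by simp
  then have "vle T x d"
    using T.ex_maximal_below[OF Domain_C_verts, of x c] d m M_subset_C by auto
  then show False using cluster_memI[OF S'(1) m] S'(2) xy(2) by simp
qed

lemma coupling_C: "coupling T G C"
proof -
  interpret J: matched_interleaving G T \<epsilon> \<beta> \<alpha> "M\<inverse>" by (rule swap)
  have J_clusters: "S\<inverse> \<in> common_clusters G T (M\<inverse>)" if "S \<in> common_clusters T G M" for S
    using that common_clusters_converse by blast
  have less_G: "vless G (LCA G (Range S)) (LCA G (Range S')) \<longleftrightarrow> S \<subset> S'"
    if "S \<in> common_clusters T G M" "S' \<in> common_clusters T G M" for S S'
  proof -
    have "S\<inverse> \<subset> S'\<inverse> \<longleftrightarrow> S \<subset> S'" by auto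
    then show ?thesis using J.cluster_less_iff[OF J_clusters[OF that(1)] J_clusters[OF that(2)]] by simp
  qed
  have inj_G: "S = S'" if "S \<in> common_clusters T G M" "S' \<in> common_clusters T G M"
    "LCA G (Range S) = LCA G (Range S')" for S S'
    using J.cluster_LCA_inj[OF J_clusters[OF that(1)] J_clusters[OF that(2)]] that(3) by simp
  let ?t = "(LCA T (Domain M), LCA G (Range M))"
  have max: "coupling_max T G C = {?t}"
  proof
    show "{?t} \<subseteq> coupling_max T G C"
      using M_cluster cluster_less_iff[OF M_cluster] cluster_subset(1)
      by (fastforce simp: coupling_max_def cluster_coupling_def)
    show "coupling_max T G C \<subseteq> {?t}"
    proof
      fix p assume p: "p \<in> coupling_max T G C"
      then obtain S where S: "S \<in> common_clusters T G M" "p = (LCA T (Domain S), LCA G (Range S))"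
        by (auto simp: coupling_max_def cluster_coupling_def)
      have "?t \<in> C" using M_cluster by (auto simp: cluster_coupling_def)
      then have "\<not> S \<subset> M"
        using p S cluster_less_iff[OF S(1) M_cluster] less_G[OF S(1) M_cluster]
        by (auto simp: coupling_max_def)
      then show "p \<in> {?t}" using S cluster_subset(1)[OF S(1)] by auto
    qed
  qed
  show ?thesis
    unfolding coupling_def
  proof (intro conjI)
    show "C \<subseteq> verts T \<times> verts G"
      using Domain_C_verts J.Domain_C_verts by (auto simp: cluster_coupling_converse)
    show "card (coupling_max T G C) = 1" using max by simp
    show "inj_on fst C" using cluster_LCA_inj by (fastforce simp: inj_on_def cluster_coupling_def)
    show "inj_on snd C" using inj_G by (fastforce simp: inj_on_def cluster_coupling_def)
    show "\<forall>(a, b)\<in>C. \<forall>(c, d)\<in>C. vless T a c \<longleftrightarrow> vless G b d"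
      using cluster_less_iff less_G by (auto simp: cluster_coupling_def)
    show "\<forall>a\<in>Domain C. card (Lam T (Domain C) a) \<noteq> 1" using card_Lam_C by blast
    show "\<forall>b\<in>Range C. card (Lam G (Range C) b) \<noteq> 1"
      using J.card_Lam_C by (auto simp: cluster_coupling_converse)
  qed
qed

end

section \<open>The cost of the coupling\<close>

context matched_interleaving
begin

lemma match_below_Domain_C:
  assumes "c \<in> Domain C" "vle T c v"
  obtains x y where "(x, y) \<in> M" "vle T x v"
proof -
  obtain S where S: "S \<in> common_clusters T G M" "c = LCA T (Domain S)"
    using assms(1) by (auto simp: Domain_C)
  then obtain x y where xy: "(x, y) \<in> S" using cluster_subset(2)[OF S(1)] by auto
  have "(x, y) \<in> M" using xy cluster_subset(1)[OF S(1)] by blast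
  moreover have "vle T x v" using cluster_upper[OF S(1) xy] S(2) assms(2) T.vle_trans by blast
  ultimately show ?thesis using that by blast
qed

lemma match_below_Lam:
  assumes x: "x \<notin> Domain C" and m: "(a, b) \<in> M" "vle T a x"
  obtains c where "c \<in> Lam T (Domain C) x" "vle T a c"
proof -
  have "a \<in> Domain C" using m(1) M_subset_C by blast
  moreover have "vless T a x" using m x \<open>a \<in> Domain C\<close> by (auto simp: vless_def)
  ultimately show ?thesis using T.ex_maximal_below[OF Domain_C_verts, of a x] that by blast
qed

lemma pt_below_shift:
  assumes p: "p \<in> points T" and q: "q \<in> points T" and le: "ple T p q" "pheight q \<le> pheight p + 2 * \<epsilon>"
  shows "ple T q (shift T (2 * \<epsilon>) p)"
  using T.point_above_ple[OF p _ q le(1)] le(2) eps by (simp add: shift_def)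

text \<open>Let no match lie below \<open>x\<close>. Some persistent vertex \<open>l\<close>, no higher than \<open>x\<close>, lies below the shift
  of \<open>x\<close>; as \<open>l\<close> is matched, \<open>phi\<close> is at most \<open>2 * \<epsilon>\<close> above \<open>x\<close>. A match \<open>(a, b)\<close> below \<open>phi\<close> with \<open>b\<close>
  higher than \<open>height T x + \<epsilon>\<close> cannot exist: \<open>a\<close> would lose against \<open>l\<close>, so would not be persistent,
  and \<open>b\<close> would lose against the partner of \<open>l\<close>, though one of \<open>a\<close> and \<open>b\<close> is persistent.\<close>

lemma deleted_without_matches:
  assumes x: "x \<in> verts T" and no: "\<And>a b. (a, b) \<in> M \<Longrightarrow> \<not> vle T a x"
  defines "p \<equiv> phi T (Domain C) x"
  shows "height T x \<le> height T p" "height T p \<le> height T x + 2 * \<epsilon>"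
    and "eta T G C x \<in> verts G" "height G (eta T G C x) \<le> height T x + \<epsilon>"
proof -
  note xp = T.pt_in[OF x]
  let ?s = "shift T (2 * \<epsilon>) (pt T x)"
  have s: "?s \<in> points T" "ple T (pt T x) ?s" "pheight ?s = height T x + 2 * \<epsilon>"
    using T.shift_in[OF xp] T.shift_ple[OF xp] T.pheight_shift[OF xp] eps by auto
  obtain l where l: "l \<in> persistent T (2 * \<epsilon>)" "ple T (pt T l) ?s" "height T l \<le> height T x"
    using T.persistent_in_shift[OF x, of "2 * \<epsilon>"] eps by auto
  then obtain w where lw: "(l, w) \<in> M" using M_covers(1) by blast
  note lv = M_verts(1)[OF lw] and wv = M_verts(2)[OF lw]
  let ?V = "{v \<in> verts T. vless T x v \<and> (\<exists>v'\<in>Domain C. vle T v' v)}"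
  have lC: "l \<in> Domain C" using lw M_subset_C by blast
  have xs: "vle T x (fst ?s)" using s(1,2) T.ple_pt[OF x s(1)] by simp
  have ls: "vle T l (fst ?s)" using l(2) T.ple_pt[OF lv s(1)] by simp
  have "x \<noteq> fst ?s" using no[OF lw] ls by auto
  then have v0: "fst ?s \<in> ?V" using T.points_fst[OF s(1)] xs ls lC by (auto simp: vless_def)
  have V: "?V \<subseteq> {v \<in> verts T. vle T x v}" by (auto simp: vless_def)
  have pV: "p \<in> ?V" and p_le: "vle T p (fst ?s)"
    unfolding p_def phi_def using T.least_in_chain[OF V] v0 by blast+
  have pv: "p \<in> verts T" using pV by simp
  show "height T x \<le> height T p" using T.vle_height[OF _ x] pV by (auto simp: vless_def)
  have "height T p \<le> height T (fst ?s)" by (rule T.vle_height[OF p_le pv])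
  then show "height T p \<le> height T x + 2 * \<epsilon>" using T.points_height[OF s(1)] s(3) by simp
  obtain v' where v': "v' \<in> Domain C" "vle T v' p" using pV by blast
  then obtain a b where ab: "(a, b) \<in> M" "vle T a p" by (rule match_below_Domain_C)
  note av = M_verts(1)[OF ab(1)] and bv = M_verts(2)[OF ab(1)]
  have as: "ple T (pt T a) ?s" using T.ple_pt[OF av s(1)] T.vle_trans[OF ab(2) p_le] by simp
  have b_low: "height G b \<le> height T x + \<epsilon>"
  proof (rule ccontr)
    assume high: "\<not> height G b \<le> height T x + \<epsilon>"
    then have ax: "height T x < height T a" using M_heights(1)[OF ab(1)] by simp
    have "a \<notin> persistent T (2 * \<epsilon>)"
    proof
      assume a: "a \<in> persistent T (2 * \<epsilon>)"
      have "ple T ?s (shift T (2 * \<epsilon>) (pt T a))"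
        using pt_below_shift[OF T.pt_in[OF av] s(1) as] s(3) ax by simp
      then have "ple T (pt T l) (shift T (2 * \<epsilon>) (pt T a))" using l(2) T.ple_trans by blast
      then have "height T a \<le> height T l" using T.persistent_le[OF a T.pt_in[OF lv]] by simp
      then show False using l(3) ax by simp
    qed
    then have b: "b \<in> persistent G (2 * \<epsilon>)" using M_persistent[OF ab(1)] by blast
    have below: "ple G (pt G b) (\<alpha> ?s)" "ple G (pt G w) (\<alpha> ?s)"
      using M_below[OF ab(1) s(1)] M_below[OF lw s(1)] T.ple_pt[OF av s(1)] as ls
        G.ple_pt[OF bv \<alpha>_in[OF s(1)]] G.ple_pt[OF wv \<alpha>_in[OF s(1)]] by auto
    have "ple G (\<alpha> ?s) (shift G (2 * \<epsilon>) (pt G b))"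
      using matched_interleaving.pt_below_shift[OF swap G.pt_in[OF bv] \<alpha>_in[OF s(1)] below(1)]
        \<alpha>_height[OF s(1)] s(3) high by simp
    then have "ple G (pt G w) (shift G (2 * \<epsilon>) (pt G b))" using below(2) G.ple_trans by blast
    then have "height G b \<le> height G w" using G.persistent_le[OF b G.pt_in[OF wv]] by simp
    then show False using M_heights(1)[OF lw] l(3) high by simp
  qed
  let ?W = "{w. \<exists>v. (v, w) \<in> C \<and> vle T v p}"
  have bW: "b \<in> ?W" using ab M_subset_C by blast
  have W: "?W \<subseteq> verts G" using coupling_C by (auto simp: coupling_def)
  then have fin: "finite ?W" using G.finite_verts finite_subset by blast
  have "eta T G C x \<in> ?W"
    unfolding eta_def p_def[symmetric] using arg_min_if_finite(1)[OF fin] bW by blast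
  then show "eta T G C x \<in> verts G" using W by blast
  have "height G (eta T G C x) \<le> height G b"
    unfolding eta_def p_def[symmetric] using arg_min_least[OF fin _ bW] bW by blast
  then show "height G (eta T G C x) \<le> height T x + \<epsilon>" using b_low by simp
qed

lemma cluster_height:
  assumes S: "S \<in> common_clusters T G M"
  shows "height G (LCA G (Range S)) \<le> height T (LCA T (Domain S)) + \<epsilon>"
  using LCA_Range_height[OF cluster_subset[OF S] cluster_LCA_in[OF S]] cluster_upper[OF S] by blast

lemma coupled_height:
  assumes xy: "(x, y) \<in> C"
  shows "\<bar>height G y - height T x\<bar> \<le> \<epsilon>"
proof -
  obtain S where S: "S \<in> common_clusters T G M" "x = LCA T (Domain S)" "y = LCA G (Range S)"
    using xy by (rule C_E)
  have "S\<inverse> \<in> common_clusters G T (M\<inverse>)" using S(1) common_clusters_converse by blast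
  then have "height T x \<le> height G y + \<epsilon>"
    using matched_interleaving.cluster_height[OF swap] S by fastforce
  moreover have "height G y \<le> height T x + \<epsilon>" using cluster_height S by simp
  ultimately show ?thesis by (simp add: abs_le_iff)
qed

text \<open>The partners of the clusters directly below \<open>x\<close> have the same upper bounds as the partners of
  all the leaves matched below \<open>x\<close>.\<close>

lemma chi_eq_LCA:
  assumes x: "x \<notin> Domain C"
  shows "chi T G C x = LCA G (Range {(a, b) \<in> M. vle T a x})"
proof -
  let ?S = "{(a, b) \<in> M. vle T a x}" and ?W = "{w. \<exists>v. (v, w) \<in> C \<and> v \<in> Lam T (Domain C) x}"
  have "(\<forall>w\<in>?W. vle G w u) \<longleftrightarrow> (\<forall>b\<in>Range ?S. vle G b u)" if u: "u \<in> verts G" for u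
  proof
    assume W: "\<forall>w\<in>?W. vle G w u"
    show "\<forall>b\<in>Range ?S. vle G b u"
    proof
      fix b assume "b \<in> Range ?S"
      then obtain a where ab: "(a, b) \<in> M" "vle T a x" by blast
      obtain c where c: "c \<in> Lam T (Domain C) x" "vle T a c" using match_below_Lam[OF x ab] .
      then obtain d where cd: "(c, d) \<in> C" by (auto simp: Lam_def)
      then obtain S where S: "S \<in> common_clusters T G M" "c = LCA T (Domain S)" "d = LCA G (Range S)"
        by (rule C_E)
      have "(a, b) \<in> S" using cluster_memI[OF S(1) ab(1)] c(2) S(2) by simp
      moreover have "S\<inverse> \<in> common_clusters G T (M\<inverse>)" using S(1) common_clusters_converse by blast
      ultimately have "vle G b d"
        using matched_interleaving.cluster_upper[OF swap, of "S\<inverse>" b a] S(3) by simp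
      then show "vle G b u" using W c(1) cd G.vle_trans by blast
    qed
  next
    assume R: "\<forall>b\<in>Range ?S. vle G b u"
    show "\<forall>w\<in>?W. vle G w u"
    proof
      fix w assume "w \<in> ?W"
      then obtain v where v: "(v, w) \<in> C" "v \<in> Lam T (Domain C) x" by blast
      obtain S where S: "S \<in> common_clusters T G M" "v = LCA T (Domain S)" "w = LCA G (Range S)"
        using v(1) by (rule C_E)
      have vx: "vle T v x" using v(2) by (simp add: Lam_def vless_def)
      have sub: "S \<subseteq> ?S"
        using cluster_upper[OF S(1)] S(2) cluster_subset(1)[OF S(1)] T.vle_trans[OF _ vx] by auto
      have "Range S \<subseteq> verts G" "Range S \<noteq> {}" using cluster_subset[OF S(1)] M_verts by auto
      then have "vle G (LCA G (Range S)) u" using u by (rule G.LCA_least) (use R sub in blast)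
      then show "vle G w u" using S(3) by simp
    qed
  qed
  then have "{u \<in> verts G. \<forall>w\<in>?W. vle G w u} = {u \<in> verts G. \<forall>b\<in>Range ?S. vle G b u}"
    by blast
  then show ?thesis by (simp only: chi_def LCA_def)
qed

text \<open>Let \<open>S\<close> be the set of matches below \<open>x\<close>. If \<open>S\<close> were all that is matched below \<open>chi\<close>, it would be
  a common cluster, and \<open>x\<close> would be unused. So the map \<open>\<beta>\<close> sends \<open>chi\<close> above a leaf that is not
  below \<open>x\<close>, but also above one that is; hence above \<open>x\<close>.\<close>

lemma deleted_with_matches:
  assumes x: "x \<in> verts T" "x \<notin> Domain C" and Lam: "Lam T (Domain C) x \<noteq> {}" "card (Lam T (Domain C) x) \<noteq> 1"
  shows "\<bar>height G (chi T G C x) - height T x\<bar> \<le> \<epsilon>"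
proof -
  interpret J: matched_interleaving G T \<epsilon> \<beta> \<alpha> "M\<inverse>" by (rule swap)
  define S where "S = {(a, b) \<in> M. vle T a x}"
  define y where "y = LCA G (Range S)"
  have chi: "chi T G C x = y" using chi_eq_LCA[OF x(2)] by (simp add: y_def S_def)
  have sub: "S \<subseteq> M" by (auto simp: S_def)
  obtain c where c: "c \<in> Lam T (Domain C) x" using Lam(1) by blast
  then have "c \<in> Domain C" "vle T c x" by (auto simp: Lam_def vless_def)
  then obtain a b where "(a, b) \<in> M" "vle T a x" by (rule match_below_Domain_C)
  then have ab: "(a, b) \<in> S" by (simp add: S_def)
  then have ne: "S \<noteq> {}" by blast
  have DS: "Domain S \<subseteq> verts T" "Domain S \<noteq> {}" and RS: "Range S \<subseteq> verts G" "Range S \<noteq> {}"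
    using sub ne M_verts by auto
  have Sx: "vle T a x" if "a \<in> Domain S" for a using that by (auto simp: S_def)
  have up: "height G y \<le> height T x + \<epsilon>"
    unfolding y_def using LCA_Range_height[OF sub ne x(1) Sx] .
  have yv: "y \<in> verts G" unfolding y_def using G.LCA_in[OF RS] .
  have y_upper: "vle G b y" if "b \<in> Range S" for b unfolding y_def using G.LCA_upper[OF RS that] .
  have "\<exists>(a', b')\<in>M. vle G b' y \<and> \<not> vle T a' x"
  proof (rule ccontr)
    assume "\<not> (\<exists>(a', b')\<in>M. vle G b' y \<and> \<not> vle T a' x)"
    then have y_S: "S = {(a, b) \<in> M. vle G b y}" using y_upper by (auto simp: S_def)
    let ?a = "LCA T (Domain S)"
    have ax: "vle T ?a x" using T.LCA_least[OF DS x(1)] Sx by blast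
    have a_S: "S = {(a, b) \<in> M. vle T a ?a}"
    proof
      show "S \<subseteq> {(a, b) \<in> M. vle T a ?a}" using sub T.LCA_upper[OF DS] by auto
      show "{(a, b) \<in> M. vle T a ?a} \<subseteq> S" using T.vle_trans[OF _ ax] by (auto simp: S_def)
    qed
    have S: "S \<in> common_clusters T G M"
      unfolding common_clusters_def mem_Collect_eq
      by (intro conjI ne a_S y_S[unfolded y_def])
    have aC: "?a \<in> Domain C" using S by (auto simp: Domain_C)
    then have less: "vless T ?a x" using ax x(2) by (auto simp: vless_def)
    have "d = ?a" if d: "d \<in> Lam T (Domain C) x" for d
    proof -
      have dC: "d \<in> Domain C" "vle T d x" using d by (auto simp: Lam_def vless_def)
      obtain S' where S': "S' \<in> common_clusters T G M" "d = LCA T (Domain S')"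
        using dC(1) by (auto simp: Domain_C)
      have "S' \<subseteq> S"
        using cluster_subset(1)[OF S'(1)] cluster_upper[OF S'(1)] T.vle_trans[OF _ dC(2)] S'(2)
        by (auto simp: S_def)
      then have "vle T d ?a" using cluster_le_iff[OF S'(1) S] S'(2) by simp
      then show ?thesis using d aC less by (auto simp: Lam_def vless_def)
    qed
    then have "Lam T (Domain C) x = {?a}" using c by blast
    then show False using Lam(2) by simp
  qed
  then obtain a' b' where ab': "(a', b') \<in> M" "vle G b' y" "\<not> vle T a' x" by blast
  note yp = G.pt_in[OF yv] and xp = T.pt_in[OF x(1)]
  have below: "vle T a (fst (\<beta> (pt G y)))" "vle T a' (fst (\<beta> (pt G y)))"
    using J.M_below[OF _ yp, of b a] J.M_below[OF _ yp, of b' a'] ab sub y_upper ab' by auto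
  have av: "a \<in> verts T" using ab DS(1) by blast
  have "ple T (pt T x) (\<beta> (pt G y)) \<or> ple T (\<beta> (pt G y)) (pt T x)"
    using T.ple_linear[OF xp \<beta>_in[OF yp], of "pt T a"] T.ple_pt[OF av] xp \<beta>_in[OF yp] below(1) Sx ab
    by auto
  moreover have "\<not> ple T (\<beta> (pt G y)) (pt T x)"
    using below(2) ab'(3) T.vle_trans by (auto simp: ple_def)
  ultimately have "height T x \<le> height G y + \<epsilon>"
    using T.ple_pheight \<beta>_height[OF yp] by fastforce
  then show ?thesis using up chi by (simp add: abs_le_iff)
qed

lemma vertex_cost:
  assumes x: "x \<in> verts T" "card (Lam T (Domain C) x) \<noteq> 1"
  shows "\<bar>pheight (vertex_map T G C x) - height T x\<bar> \<le> \<epsilon>"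
proof -
  consider "x \<in> Domain C" | "x \<notin> Domain C" "Lam T (Domain C) x = {}"
    | "x \<notin> Domain C" "Lam T (Domain C) x \<noteq> {}" by blast
  then show ?thesis
  proof cases
    case 1
    then obtain y where y: "(x, y) \<in> C" by blast
    have "inj_on fst C" using coupling_C by (simp add: coupling_def)
    then have "y' = y" if "(x, y') \<in> C" for y' using inj_onD[of fst C "(x, y')" "(x, y)"] y that by simp
    then have "(THE y. (x, y) \<in> C) = y" using y by (intro the_equality)
    then show ?thesis using 1 coupled_height[OF y] by (simp add: vertex_map_def)
  next
    case 2
    have no: "\<not> vle T a x" if "(a, b) \<in> M" for a b
      using match_below_Lam[OF 2(1) that] 2(2) by blast
    let ?e = "eta T G C x" and ?p = "phi T (Domain C) x"
    have bounds: "height T x \<le> height T ?p" "height T ?p \<le> height T x + 2 * \<epsilon>"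
      "?e \<in> verts G" "height G ?e \<le> height T x + \<epsilon>"
      by (rule deleted_without_matches[OF x(1)], erule no)+
    have "pheight (vertex_map T G C x) = max (height G ?e) ((height T x + height T ?p) / 2)"
      using 2 G.pheight_above[OF G.pt_in[OF bounds(3)]] by (simp add: vertex_map_def)
    moreover have "\<bar>max (height G ?e) ((height T x + height T ?p) / 2) - height T x\<bar> \<le> \<epsilon>"
      using bounds(1,2,4) by (auto simp: max_def abs_le_iff field_simps)
    ultimately show ?thesis by simp
  next
    case 3
    then show ?thesis using deleted_with_matches[OF x(1) 3(1,2) x(2)] by (simp add: vertex_map_def)
  qed
qed

lemma half_cost_le: "half_cost T G C \<le> \<epsilon>"
proof -
  \<comment> \<open>The maximum is taken over a nonempty set: the top of the coupling belongs to it.\<close>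
  have "LCA T (Domain M) \<in> Domain C" using M_cluster by (auto simp: Domain_C)
  then have "LCA T (Domain M) \<in> verts T - unused T (Domain C)"
    using card_Lam_C Domain_C_verts by (auto simp: unused_def)
  then show ?thesis
    unfolding half_cost_def using T.finite_verts vertex_cost
    by (subst Max_le_iff) (auto simp: unused_def)
qed

end

theorem theorem2:
  fixes T :: "'v mtree" and G :: "'w mtree" and \<epsilon> :: real
    and \<alpha> :: "'v \<times> real \<Rightarrow> 'w \<times> real" and \<beta> :: "'w \<times> real \<Rightarrow> 'v \<times> real"
  assumes "merge_tree T" and "merge_tree G" and "\<epsilon> \<ge> 0"
    and "good_map T G \<epsilon> \<alpha>" and "good_map G T \<epsilon> \<beta>"
  shows "\<exists>C. coupling T G C \<and> coupling_cost T G C \<le> \<epsilon>"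
proof -
  interpret good_map_between T G \<epsilon> \<alpha>
    using assms by (simp add: good_map_between_def good_map_between_axioms_def)
  obtain \<gamma> where "interleaving T G \<epsilon> \<alpha> \<gamma>" using ex_interleaving by blast
  then obtain \<alpha>' \<beta>' M where M: "matched_interleaving T G \<epsilon> \<alpha>' \<beta>' M"
    using interleaving.ex_matched_interleaving by blast
  interpret M: matched_interleaving T G \<epsilon> \<alpha>' \<beta>' M by (rule M)
  have "half_cost G T (M.C\<inverse>) \<le> \<epsilon>"
    using matched_interleaving.half_cost_le[OF M.swap] by (simp add: cluster_coupling_converse)
  then have "coupling_cost T G M.C \<le> \<epsilon>" using M.half_cost_le by (simp add: coupling_cost_def)
  then show ?thesis using M.coupling_C by blast
qed

end
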